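(* Let $G$ be a finite graph. The Markov width $\mu(G)$ of $G$ is at most four if and only if $G$ does not contain $K_4$ as a minor. In particular, $\mu(G)=4$ if and only if $G$ is not a forest and $G$ does not contain $K_4$ as a minor.
   Context: Graphs are finite and simple. For a finite set $X$ with $|X|=n$, let $\mathcal{Z}(X)\simeq\mathbb{Z}^{2^n}$ denote the integral lattice (free abelian group) with orthonormal basis $\{e_a\}$ indexed by all binary labelings $a:X\to\{0,1\}$. A vector of $\mathcal{Z}(X)$ is non-negative if all its coordinates in this basis are non-negative, and $\|\cdot\|_1$ is the $\ell_1$-norm with respect to this basis. For $Y\subseteq X$, let $\pi_{Y}=\pi_{X\to Y}:\mathcal{Z}(X)\to\mathcal{Z}(Y)$ be the linear extension of the map $e_a\mapsto e_{a|_Y}$; write $\pi_{ij}$ for $\pi_{\{i,j\}}$. For a graph $G$, let $\pi_G$ be the linear map on $\mathcal{Z}(V(G))$ obtained as the product of the maps $\pi_{ij}$ over all edges $ij\in E(G)$, i.e. $\pi_G(z)=(\pi_{ij}(z))_{ij\in E(G)}$. A finite subset $B\subseteq\ker(\pi_G)$ is a Markov basis of $G$ if for all non-negative vectors $v_1,v_2\in\mathcal{Z}(V(G))$ with $\pi_G(v_1)=\pi_G(v_2)$ there exist $u_1,\ldots,u_\ell\in\pm B$ such that $v_1+\sum_{k=1}^{\ell}u_k=v_2$ and $v_1+\sum_{k=1}^{\ell'}u_k$ is non-negative for all $1\le\ell'\le\ell$. The Markov width $\mu(G)$ is the smallest integer $k$ such that there exists a Markov basis $B$ of $G$ with $\|v\|_1\le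 2k$ for every $v\in B$. *)

theory Defs
  imports
    "HOL-Library.Poly_Mapping"
    "HOL-Library.FuncSet"
    "HOL-Library.Disjoint_Sets"
    "HOL-Library.Extended_Nat"
begin

section \<open>Finite simple graphs, minors and forests\<close>

type_synonym 'a ugraph = "'a set \<times> 'a set set"

abbreviation verts :: "'a ugraph \<Rightarrow> 'a set" where
  "verts G \<equiv> fst G"

abbreviation edges :: "'a ugraph \<Rightarrow> 'a set set" where
  "edges G \<equiv> snd G"

definition finite_simple_graph :: "'a ugraph \<Rightarrow> bool" where
  "finite_simple_graph G \<longleftrightarrow>
     finite (verts G) \<and> (\<forall>e\<in>edges G. e \<subseteq> verts G \<and> card e = 2)"

definition complete_ugraph :: "nat \<Rightarrow> nat ugraph" where
  "complete_ugraph n = ({..<n}, {e. e \<subseteq> {..<n} \<and> card e = 2})"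

definition connected_in :: "'a ugraph \<Rightarrow> 'a set \<Rightarrow> bool" where
  "connected_in G S \<longleftrightarrow>
     S \<noteq> {} \<and> (\<forall>x\<in>S. \<forall>y\<in>S. (x, y) \<in> {(u, v). u \<in> S \<and> v \<in> S \<and> {u, v} \<in> edges G}\<^sup>*)"

(* Branch-set definition of minors: contracting each set Br x to the vertex x, and
   deleting superfluous vertices and edges, turns G into H. *)
definition is_minor :: "'b ugraph \<Rightarrow> 'a ugraph \<Rightarrow> bool" where
  "is_minor H G \<longleftrightarrow> (\<exists>Br :: 'b \<Rightarrow> 'a set.
     (\<forall>x\<in>verts H. Br x \<subseteq> verts G \<and> connected_in G (Br x)) \<and>
     disjoint_family_on Br (verts H) \<and>
     (\<forall>x y. {x, y} \<in> edges H \<longrightarrow> (\<exists>u\<in>Br x. \<exists>v\<in>Br y. {u, v} \<in> edges G)))"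

definition is_cycle :: "'a ugraph \<Rightarrow> 'a list \<Rightarrow> bool" where
  "is_cycle G xs \<longleftrightarrow>
     3 \<le> length xs \<and> distinct xs \<and> set xs \<subseteq> verts G \<and>
     (\<forall>i<length xs. {xs ! i, xs ! (Suc i mod length xs)} \<in> edges G)"

definition is_forest :: "'a ugraph \<Rightarrow> bool" where
  "is_forest G \<longleftrightarrow> \<not> (\<exists>xs. is_cycle G xs)"


section \<open>The lattice of binary labelings and its projections\<close>

definition labelings :: "'a set \<Rightarrow> ('a \<Rightarrow> nat) set" where
  "labelings X = X \<rightarrow>\<^sub>E {0, 1}"

type_synonym 'a label_vec = "('a \<Rightarrow> nat) \<Rightarrow>\<^sub>0 int"

(* The basis vector e_a is frag_of a. *)
definition lattice :: "'a set \<Rightarrow> 'a label_vec set" where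
  "lattice X = {z. Poly_Mapping.keys z \<subseteq> labelings X}"

definition nonneg :: "'a label_vec \<Rightarrow> bool" where
  "nonneg z \<longleftrightarrow> (\<forall>a. 0 \<le> Poly_Mapping.lookup z a)"

definition l1_norm :: "'a label_vec \<Rightarrow> int" where
  "l1_norm z = (\<Sum>a\<in>Poly_Mapping.keys z. \<bar>Poly_Mapping.lookup z a\<bar>)"

definition proj :: "'a set \<Rightarrow> 'a label_vec \<Rightarrow> 'a label_vec" where
  "proj Y = frag_extend (\<lambda>a. frag_of (restrict a Y))"

definition graph_proj :: "'a ugraph \<Rightarrow> 'a label_vec \<Rightarrow> ('a set \<Rightarrow> 'a label_vec)" where
  "graph_proj G z = (\<lambda>e\<in>edges G. proj e z)"

(* The zero of the product over the edges is the extensional constant-zero family. *)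
definition graph_kernel :: "'a ugraph \<Rightarrow> 'a label_vec set" where
  "graph_kernel G = {z \<in> lattice (verts G). graph_proj G z = (\<lambda>e\<in>edges G. 0)}"


section \<open>Markov bases and Markov width\<close>

definition markov_basis :: "'a ugraph \<Rightarrow> 'a label_vec set \<Rightarrow> bool" where
  "markov_basis G B \<longleftrightarrow>
     finite B \<and> B \<subseteq> graph_kernel G \<and>
     (\<forall>v1\<in>lattice (verts G). \<forall>v2\<in>lattice (verts G).
        nonneg v1 \<and> nonneg v2 \<and> graph_proj G v1 = graph_proj G v2 \<longrightarrow>
        (\<exists>us. set us \<subseteq> B \<union> uminus ` B \<and>
              v1 + sum_list us = v2 \<and>
              (\<forall>l\<in>{1..length us}. nonneg (v1 + sum_list (take l us)))))"

(* The infimum in enat is the least such k if there is one, and infinity otherwise. *)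
definition markov_width :: "'a ugraph \<Rightarrow> enat" where
  "markov_width G =
     Inf {enat k | k. \<exists>B. markov_basis G B \<and> (\<forall>v\<in>B. l1_norm v \<le> 2 * int k)}"

end

theory Submission
  imports Defs "HOL-Library.Multiset"
begin

text \<open>A non-negative vector is a multiset of rows, a row being the set of vertices labeled 1.

  Upper bound. A \<open>K\<^sub>4\<close>-minor-free graph has a vertex \<open>x\<close> of degree at most two. If its neighbors
  \<open>p\<close>, \<open>q\<close> are adjacent, moves of \<open>G - x\<close> lift to \<open>G\<close>, and the rest is a triangle move (four rows)
  and conditional independence (two rows). If they are not adjacent, then \<open>G - x + pq\<close> is a minor
  of \<open>G\<close>, and it remains to pass between the fibers of \<open>G + pq\<close> contained in one fiber of \<open>G\<close>.
  These are indexed by the number of rows containing both \<open>p\<close> and \<open>q\<close>; moves of two rows change this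
  number by at most one, so intermediate values are never skipped, and such a move on \<open>G - x\<close> lifts
  to \<open>G\<close> once both of its rows carry the same label of \<open>x\<close>, which can be arranged. For forests only two-row moves are needed.

  Lower bound. A fiber of \<open>K\<^sub>3\<close> (degree four) and one of \<open>K\<^sub>4\<close> (degree six) consist of two disjoint
  tables, and this persists in every graph having \<open>K\<^sub>3\<close> or \<open>K\<^sub>4\<close> as a minor.\<close>

section \<open>Tables and links\<close>

text \<open>Connectivity is treated relatively: \<open>linked k V E F\<close> regards tables with
  equal \<open>F\<close>-marginals as one point and asks that moves of at most \<open>k\<close> rows
  connect every fiber of \<open>E\<close>. Such statements compose, so full connectivity,
  \<open>F = {V}\<close>, is reached by fixing more and more marginals, each by its own local
  argument.

  The obstacle is a deleted vertex x with non-adjacent neighbors p, q. A move of the remaining graph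
  lifts when its old and new rows can be matched by their labels at p and q, the new rows inheriting
  the labels of x; this needs the {p, q}-marginal to be preserved, and without the edge pq nothing
  guarantees that. Hence that marginal is adjusted beforehand, by two-row moves: such a move, if it
  raises the number of rows containing p and q, must remove exactly one row with p alone and one
  with q alone, and a common label of x at these two rows makes it harmless for the edges at x.

  The adjustment for a pair y, z is itself a recursion over vertices and must never delete y or z.
  This is why the existence of a vertex of degree at most two is proved in the stronger form that
  avoids the ends of a prescribed edge.\<close>

definition tables :: "'a set \<Rightarrow> 'a set multiset set" where
  "tables V = {M. \<forall>a\<in>#M. a \<subseteq> V}"

definition marg :: "'a set \<Rightarrow> 'a set multiset \<Rightarrow> 'a set multiset" where
  "marg e M = image_mset (\<lambda>a. a \<inter> e) M"

definition same :: "'a set set \<Rightarrow> 'a set multiset \<Rightarrow> 'a set multiset \<Rightarrow> bool" where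
  "same E M N \<longleftrightarrow> (\<forall>e\<in>E. marg e M = marg e N)"

text \<open>\<open>C\<close> is the untouched part. The sizes of \<open>A\<close> and
  \<open>B\<close> may differ: a common marginal on some set forces them to agree, and in a graph
  without edges rows may be deleted.\<close>

definition move :: "nat \<Rightarrow> 'a multiset \<Rightarrow> 'a multiset \<Rightarrow> bool" where
  "move k M N \<longleftrightarrow> (\<exists>A B C. M = A + C \<and> N = B + C \<and> size A \<le> k \<and> size B \<le> k)"

text \<open>The second alternative is a free jump inside a fiber of \<open>F\<close>, changing any
  number of rows at once.\<close>

definition steps :: "nat \<Rightarrow> 'a set \<Rightarrow> 'a set set \<Rightarrow> 'a set set \<Rightarrow> 'a set multiset rel" where
  "steps k V E F = {(M, N). M \<in> tables V \<and> N \<in> tables V \<and> same E M N \<and> (move k M N \<or> same F M N)}"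

definition linked :: "nat \<Rightarrow> 'a set \<Rightarrow> 'a set set \<Rightarrow> 'a set set \<Rightarrow> bool" where
  "linked k V E F \<longleftrightarrow> (\<forall>M\<in>tables V. \<forall>N\<in>tables V. same E M N \<longrightarrow> (M, N) \<in> (steps k V E F)\<^sup>*)"

lemma tables_add [simp]: "M + N \<in> tables V \<longleftrightarrow> M \<in> tables V \<and> N \<in> tables V"
  by (auto simp: tables_def)

lemma tables_add_mset [simp]: "add_mset a N \<in> tables V \<longleftrightarrow> a \<subseteq> V \<and> N \<in> tables V"
  by (auto simp: tables_def)

lemma tables_empty [simp]: "{#} \<in> tables V"
  by (auto simp: tables_def)

lemma tables_mono: "M \<in> tables V \<Longrightarrow> V \<subseteq> W \<Longrightarrow> M \<in> tables W"
  by (auto simp: tables_def)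

lemma marg_add [simp]: "marg e (M + N) = marg e M + marg e N"
  by (simp add: marg_def)

lemma marg_add_mset [simp]: "marg e (add_mset a N) = add_mset (a \<inter> e) (marg e N)"
  by (simp add: marg_def)

lemma marg_empty [simp]: "marg e {#} = {#}"
  by (simp add: marg_def)

lemma size_marg [simp]: "size (marg e M) = size M"
  by (simp add: marg_def)

lemma marg_in_tables [simp]: "marg V M \<in> tables V"
  by (auto simp: tables_def marg_def)

lemma marg_marg: "marg e (marg f M) = marg (e \<inter> f) M"
  by (simp add: marg_def multiset.map_comp o_def Int_ac)

lemma marg_marg_subset: "e \<subseteq> f \<Longrightarrow> marg e (marg f M) = marg e M"
  by (simp add: marg_marg Int_absorb2)

lemma marg_id: "M \<in> tables V \<Longrightarrow> marg V M = M"
  unfolding marg_def tables_def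
  by (rule trans[OF image_mset_cong[where g = "\<lambda>a. a"]]) auto

lemma marg_mono: "marg f M = marg f N \<Longrightarrow> e \<subseteq> f \<Longrightarrow> marg e M = marg e N"
  by (metis marg_marg_subset)

lemma marg_Int_tables: "M \<in> tables V \<Longrightarrow> marg (e \<inter> V) M = marg e M"
  using marg_marg[of e V M] by (simp add: marg_id)

lemma same_refl [simp]: "same E M M"
  by (simp add: same_def)

lemma same_sym: "same E M N \<Longrightarrow> same E N M"
  by (simp add: same_def)

lemma same_trans: "same E M N \<Longrightarrow> same E N L \<Longrightarrow> same E M L"
  by (simp add: same_def)

lemma same_Un: "same (E \<union> F) M N \<longleftrightarrow> same E M N \<and> same F M N"
  by (auto simp: same_def)

lemma same_insert: "same (insert e F) M N \<longleftrightarrow> marg e M = marg e N \<and> same F M N"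
  by (auto simp: same_def)

lemma same_empty [simp]: "same {} M N"
  by (simp add: same_def)

lemma same_add_cancel [simp]: "same E (M + L) (N + L) \<longleftrightarrow> same E M N"
  by (simp add: same_def)

lemma same_add_mset_cancel [simp]: "same E (add_mset a M) (add_mset a N) \<longleftrightarrow> same E M N"
  by (simp add: same_def)

text \<open>A table on \<open>V\<close> sees of a set only its part in \<open>V\<close>, hence the
  intersection. In particular \<open>{V}\<close> is finer than every family.\<close>

definition finer :: "'a set \<Rightarrow> 'a set set \<Rightarrow> 'a set set \<Rightarrow> bool" where
  "finer V F E \<longleftrightarrow> (\<forall>e\<in>E. \<exists>f\<in>F. e \<inter> V \<subseteq> f)"

lemma same_finer:
  assumes "same F M N" "finer V F E" "M \<in> tables V" "N \<in> tables V"
  shows "same E M N"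
  unfolding same_def
proof
  fix e assume "e \<in> E"
  then obtain f where f: "f \<in> F" "e \<inter> V \<subseteq> f"
    using assms(2) by (auto simp: finer_def)
  have "marg (e \<inter> V) M = marg (e \<inter> V) N"
    using f assms(1) by (metis marg_mono same_def)
  then show "marg e M = marg e N"
    using assms(3,4) by (simp add: marg_Int_tables)
qed

lemma finer_superset: "E \<subseteq> F \<Longrightarrow> finer V F E"
  by (force simp: finer_def)

lemma move_refl [simp]: "move k M M"
  unfolding move_def by (intro exI[of _ "{#}"] exI[of _ M]) simp

lemma move_sym: "move k M N \<Longrightarrow> move k N M"
  unfolding move_def by blast

lemma move_mono: "move k M N \<Longrightarrow> k \<le> l \<Longrightarrow> move l M N"
  unfolding move_def by (metis order_trans)

lemma move_add: "move k M N \<Longrightarrow> move k (M + L) (N + L)"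
  unfolding move_def by (metis add.assoc)

lemma steps_sym: "(M, N) \<in> steps k V E F \<Longrightarrow> (N, M) \<in> steps k V E F"
  by (auto simp: steps_def intro: same_sym move_sym)

lemma steps_rtrancl_sym: "(M, N) \<in> (steps k V E F)\<^sup>* \<Longrightarrow> (N, M) \<in> (steps k V E F)\<^sup>*"
proof -
  have "sym (steps k V E F)"
    by (auto intro: symI steps_sym)
  then show "(M, N) \<in> (steps k V E F)\<^sup>* \<Longrightarrow> (N, M) \<in> (steps k V E F)\<^sup>*"
    by (meson sym_rtrancl symD)
qed

lemma steps_rtrancl_same: "(M, N) \<in> (steps k V E F)\<^sup>* \<Longrightarrow> same E M N"
  by (induction rule: rtrancl_induct) (auto simp: steps_def intro: same_trans)

lemma steps_rtrancl_tables: "(M, N) \<in> (steps k V E F)\<^sup>* \<Longrightarrow> M \<in> tables V \<Longrightarrow> N \<in> tables V"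
  by (induction rule: rtrancl_induct) (auto simp: steps_def)

lemma linked_mono:
  assumes "linked k V E F" "k \<le> l" "finer V E E'" "finer V E' E" "finer V F F'"
  shows "linked l V E' F'"
proof -
  have "steps k V E F \<subseteq> steps l V E' F'"
    using assms same_finer move_mono unfolding steps_def by fast
  then have "(steps k V E F)\<^sup>* \<subseteq> (steps l V E' F')\<^sup>*"
    by (rule rtrancl_mono)
  then show ?thesis
    using assms(1,4) same_finer unfolding linked_def by (metis subsetD)
qed

text \<open>A jump inside a fiber of \<open>F\<close> is itself expanded into a path, by the second
  hypothesis; that path stays in the fiber of \<open>E\<close> because \<open>F\<close> is finer
  than \<open>E\<close>.\<close>

lemma linked_trans:
  assumes "linked k V E F" "linked k V F F'" "finer V F E"
  shows "linked k V E F'"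
proof -
  have FF: "steps k V F F' \<subseteq> steps k V E F'"
    using assms same_finer unfolding steps_def by fast
  have "steps k V E F \<subseteq> (steps k V E F')\<^sup>*"
  proof clarify
    fix M N assume MN: "(M, N) \<in> steps k V E F"
    show "(M, N) \<in> (steps k V E F')\<^sup>*"
    proof (cases "move k M N")
      case True
      then show ?thesis using MN by (auto simp: steps_def)
    next
      case False
      then have "(M, N) \<in> (steps k V F F')\<^sup>*"
        using MN assms(2) by (auto simp: steps_def linked_def)
      then show ?thesis using rtrancl_mono[OF FF] by blast
    qed
  qed
  then have "(steps k V E F)\<^sup>* \<subseteq> (steps k V E F')\<^sup>*"
    by (metis rtrancl_idemp rtrancl_mono)
  then show ?thesis
    using assms(1) unfolding linked_def by blast
qed

section \<open>Gluing tables along a common marginal and lifting paths to one more vertex\<close>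

lemma image_mset_matching:
  assumes "image_mset f A = image_mset g B"
  obtains P where "image_mset fst P = A" "image_mset snd P = B"
    "\<And>a b. (a, b) \<in># P \<Longrightarrow> f a = g b"
proof -
  have "rel_mset (=) (image_mset f A) (image_mset g B)"
    using assms by (simp add: multiset.rel_eq)
  then have "rel_mset (\<lambda>a b. f a = g b) A B"
    by (simp add: multiset.rel_map)
  then obtain P where "set_mset P \<subseteq> {(a, b). f a = g b}" "image_mset fst P = A" "image_mset snd P = B"
    unfolding multiset.in_rel by blast
  then show ?thesis by (intro that[of P]) auto
qed

text \<open>The rows of \<open>M\<close> and \<open>W\<close> are paired so that partners agree on
  \<open>S\<close>; each row of \<open>W\<close> then inherits the label of \<open>x\<close> from
  its partner.\<close>

lemma extend_table:
  assumes "marg S M = marg S W" "W \<in> tables V" "x \<notin> V" "S \<subseteq> V"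
  obtains N where "N \<in> tables (insert x V)" "marg V N = W" "marg (insert x S) N = marg (insert x S) M"
proof -
  obtain P where P: "image_mset fst P = M" "image_mset snd P = W"
      and eq: "\<And>a b. (a, b) \<in># P \<Longrightarrow> a \<inter> S = b \<inter> S"
    using image_mset_matching[OF assms(1)[unfolded marg_def]] by metis
  have sub: "b \<subseteq> V" if "(a, b) \<in># P" for a b
    using that P(2) assms(2) by (force simp: tables_def)
  define N where "N = image_mset (\<lambda>(a, b). b \<union> (a \<inter> {x})) P"
  show ?thesis
  proof
    show "N \<in> tables (insert x V)"
      using sub by (force simp: tables_def N_def)
    have "marg V N = image_mset snd P"
      unfolding N_def marg_def multiset.map_comp
      by (rule image_mset_cong) (use sub assms(3) in \<open>fastforce\<close>)
    then show "marg V N = W" by (simp add: P)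
    have "marg (insert x S) N = image_mset (\<lambda>p. fst p \<inter> insert x S) P"
      unfolding N_def marg_def multiset.map_comp
    proof (rule image_mset_cong)
      fix p assume p: "p \<in># P"
      obtain a b where ab: "p = (a, b)" by force
      have "x \<notin> b" "a \<inter> S = b \<inter> S" using sub eq p ab assms(3) by auto
      then show "((\<lambda>a. a \<inter> insert x S) \<circ> (\<lambda>(a, b). b \<union> a \<inter> {x})) p = fst p \<inter> insert x S"
        using ab by auto
    qed
    also have "\<dots> = marg (insert x S) M"
      by (simp add: marg_def P(1)[symmetric] multiset.map_comp o_def)
    finally show "marg (insert x S) N = marg (insert x S) M" .
  qed
qed

text \<open>For a move, only the exchanged rows need new labels of \<open>x\<close>. Since
  \<open>S\<close> belongs to \<open>E\<close>, old and new rows have the same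
  \<open>S\<close>-marginal and can be glued, so every marginal inside \<open>insert x S\<close>
  survives. For a jump, \<open>S \<in> F\<close> allows gluing the whole table.\<close>

lemma lift_step:
  assumes M: "M \<in> tables (insert x V)" and st: "(marg V M, W) \<in> steps k V E F"
    and x: "x \<notin> V" and S: "S \<subseteq> V" "S \<in> E" "S \<in> F"
    and sub: "E \<subseteq> Pow V" "F \<subseteq> Pow V" "X \<subseteq> Pow (insert x S)"
  obtains N where "marg V N = W" "marg (insert x S) N = marg (insert x S) M"
    "(M, N) \<in> steps k (insert x V) (E \<union> X) (F \<union> X)"
proof -
  have W: "W \<in> tables V" and sE: "same E (marg V M) W"
    using st by (auto simp: steps_def)
  have ok: "(M, N) \<in> steps k (insert x V) (E \<union> X) (F \<union> X)"
    if N: "N \<in> tables (insert x V)" "marg V N = W" "marg (insert x S) N = marg (insert x S) M"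
      and mv: "move k M N \<or> same F (marg V M) W" for N
  proof -
    have X: "same X M N"
      using N(3) sub(3) unfolding same_def by (metis PowD marg_mono subset_iff)
    have "same D M N" if "D \<subseteq> Pow V" "same D (marg V M) W" for D
      using that N(2) unfolding same_def by (metis PowD marg_marg_subset subset_iff)
    then show ?thesis
      using M N(1) X sE mv sub by (auto simp: steps_def same_Un)
  qed
  show ?thesis
  proof (cases "same F (marg V M) W")
    case True
    then have "marg S M = marg S W"
      using S by (metis marg_marg_subset same_def)
    from extend_table[OF this W x S(1)] ok True show ?thesis
      using that by metis
  next
    case False
    then have "move k (marg V M) W"
      using st by (auto simp: steps_def)
    then obtain A' B' C' where ABC': "marg V M = A' + C'" "W = B' + C'" "size A' \<le> k" "size B' \<le> k"
      by (auto simp: move_def)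
    obtain A C where AC: "M = A + C" "A' = marg V A" "C' = marg V C"
      using image_mset_eq_plusD[OF ABC'(1)[unfolded marg_def]] by (auto simp: marg_def)
    have "marg S A' = marg S B'"
      using sE S ABC' by (auto simp: same_def)
    then have "marg S A = marg S B'"
      using S AC by (simp add: marg_marg_subset)
    moreover have "B' \<in> tables V" using W ABC' by simp
    ultimately obtain B where B: "B \<in> tables (insert x V)" "marg V B = B'"
        "marg (insert x S) B = marg (insert x S) A"
      using extend_table x S(1) by metis
    have "size B = size B'" using B(2) by (metis size_marg)
    then have "move k M (B + C)"
      using AC ABC' unfolding move_def by (metis size_marg)
    then show ?thesis
      using ok[of "B + C"] that[of "B + C"] AC ABC' B M by simp
  qed
qed

lemma lift_path:
  assumes M: "M \<in> tables (insert x V)" and path: "(marg V M, W) \<in> (steps k V E F)\<^sup>*"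
    and x: "x \<notin> V" and S: "S \<subseteq> V" "S \<in> E" "S \<in> F"
    and sub: "E \<subseteq> Pow V" "F \<subseteq> Pow V" "X \<subseteq> Pow (insert x S)"
  shows "\<exists>N. marg V N = W \<and> marg (insert x S) N = marg (insert x S) M \<and>
    (M, N) \<in> (steps k (insert x V) (E \<union> X) (F \<union> X))\<^sup>*"
  using path
proof (induction rule: rtrancl_induct)
  case base
  then show ?case by blast
next
  case (step Y Z)
  then obtain N where N: "marg V N = Y" "marg (insert x S) N = marg (insert x S) M"
    "(M, N) \<in> (steps k (insert x V) (E \<union> X) (F \<union> X))\<^sup>*" by blast
  have "N \<in> tables (insert x V)" using N(3) M steps_rtrancl_tables by blast
  from lift_step[OF this _ x S sub] step.hyps(2) N(1) obtain L where
    "marg V L = Z" "marg (insert x S) L = marg (insert x S) N"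
    "(N, L) \<in> steps k (insert x V) (E \<union> X) (F \<union> X)" by metis
  then show ?case using N by (metis rtrancl.rtrancl_into_rtrancl)
qed

text \<open>The lifted path ends in a table that agrees with \<open>N\<close> on all of
  \<open>V\<close> but perhaps not in the labels of \<open>x\<close>. It has the same marginals in
  \<open>F\<close> and in \<open>X\<close> as \<open>N\<close>, so one last jump finishes.\<close>

lemma linked_lift:
  assumes l: "linked k V E F" and x: "x \<notin> V" and S: "S \<subseteq> V" "S \<in> E" "S \<in> F"
    and sub: "E \<subseteq> Pow V" "F \<subseteq> Pow V" "X \<subseteq> Pow (insert x S)"
  shows "linked k (insert x V) (E \<union> X) (F \<union> X)"
  unfolding linked_def
proof (intro ballI impI)
  fix M N assume M: "M \<in> tables (insert x V)" and N: "N \<in> tables (insert x V)"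
    and s: "same (E \<union> X) M N"
  have "same E (marg V M) (marg V N)"
    using s sub unfolding same_def by (metis PowD UnI1 marg_marg_subset subsetD)
  then have "(marg V M, marg V N) \<in> (steps k V E F)\<^sup>*"
    using l by (auto simp: linked_def)
  from lift_path[OF M this x S sub] obtain L where
    L: "marg V L = marg V N" "marg (insert x S) L = marg (insert x S) M"
    "(M, L) \<in> (steps k (insert x V) (E \<union> X) (F \<union> X))\<^sup>*" by metis
  have "same (E \<union> X) L N"
    using steps_rtrancl_same[OF L(3)] s by (meson same_sym same_trans)
  moreover have "same F L N"
    using L(1) sub(2) unfolding same_def by (metis PowD marg_mono subsetD)
  moreover have "L \<in> tables (insert x V)" using L(3) M steps_rtrancl_tables by blast
  ultimately have "(L, N) \<in> steps k (insert x V) (E \<union> X) (F \<union> X)"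
    using N by (auto simp: steps_def same_Un)
  then show "(M, N) \<in> (steps k (insert x V) (E \<union> X) (F \<union> X))\<^sup>*"
    using L(3) by auto
qed

section \<open>Adding a vertex\<close>

lemma steps_add:
  assumes "(M, N) \<in> steps k V E F" "L \<in> tables V"
  shows "(M + L, N + L) \<in> steps k V E F"
  using assms by (auto simp: steps_def move_add)

lemma steps_rtrancl_add:
  assumes "(M, N) \<in> (steps k V E F)\<^sup>*" "L \<in> tables V"
  shows "(M + L, N + L) \<in> (steps k V E F)\<^sup>*"
  using assms(1)
  by (induction rule: rtrancl_induct) (auto intro: rtrancl.rtrancl_into_rtrancl steps_add[OF _ assms(2)])

lemma two_membersE:
  assumes "a \<in># M" "b \<in># M" "a \<noteq> b"
  obtains L where "M = {#a, b#} + L"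
proof -
  have "{#a, b#} \<subseteq># M"
    using assms by (simp add: insert_subset_eq_iff in_diff_count)
  then show ?thesis using that subset_mset.le_iff_add by blast
qed

lemma marg_memE:
  assumes "s \<in># marg e M"
  obtains a where "a \<in># M" "a \<inter> e = s"
  using assms by (auto simp: marg_def)

lemma count_marg_split:
  assumes "y \<notin> f" "s \<subseteq> f"
  shows "count (marg f M) s = count (marg (insert y f) M) s + count (marg (insert y f) M) (insert y s)"
proof (induction M)
  case (add a M)
  have "(a \<inter> f = s) \<longleftrightarrow> (a \<inter> insert y f = s \<or> a \<inter> insert y f = insert y s)"
    using assms by auto
  moreover have "\<not> (a \<inter> insert y f = s \<and> a \<inter> insert y f = insert y s)"
    using assms by auto
  ultimately show ?case using add by auto
qed simp

lemma count_marg_outside: "\<not> s \<subseteq> e \<Longrightarrow> count (marg e M) s = 0"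
  by (auto simp: marg_def count_eq_zero_iff)

lemma marg_eqI:
  assumes "\<And>s. s \<subseteq> e \<Longrightarrow> count (marg e M) s = count (marg e N) s"
  shows "marg e M = marg e N"
  by (rule multiset_eqI) (metis assms count_marg_outside)

text \<open>This is the model in which \<open>x\<close> is independent of the rest given
  \<open>S\<close>. If \<open>N\<close> lacks the row \<open>a\<close>, it contains a row
  \<open>b\<close> with the right labels on \<open>V\<close> and a row \<open>b2\<close> with the
  right label of \<open>x\<close>. Both agree on \<open>S\<close>, so they may exchange their labels
  of \<open>x\<close>; this produces \<open>a\<close>, which is then cancelled on both
  sides.\<close>

lemma linked_cond_indep:
  assumes x: "x \<notin> V" and S: "S \<subseteq> V"
  shows "linked 2 (insert x V) {V, insert x S} {insert x V}"
proof -
  let ?R = "steps 2 (insert x V) {V, insert x S} {insert x V}"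
  have "(M, N) \<in> ?R\<^sup>*"
    if "M \<in> tables (insert x V)" "N \<in> tables (insert x V)" "same {V, insert x S} M N" for M N
    using that
  proof (induction M arbitrary: N)
    case empty
    then have "N = {#}" by (simp add: same_insert marg_def)
    then show ?case by simp
  next
    case (add a M N)
    have mV: "marg V N = marg V (add_mset a M)" and mS: "marg (insert x S) N = marg (insert x S) (add_mset a M)"
      using add.prems by (auto simp: same_insert)
    then obtain b where b: "b \<in># N" "b \<inter> V = a \<inter> V"
      by (metis marg_add_mset marg_memE union_single_eq_member add_mset_add_single)
    obtain b2 where b2: "b2 \<in># N" "b2 \<inter> insert x S = a \<inter> insert x S"
      using mS by (metis marg_add_mset marg_memE union_single_eq_member add_mset_add_single)
    have sub: "a \<subseteq> insert x V" "b \<subseteq> insert x V" "b2 \<subseteq> insert x V" "M \<in> tables (insert x V)"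
      using add.prems(1,2) b b2 by (auto simp: tables_def)
    have "\<exists>N'. (N, add_mset a N') \<in> ?R\<^sup>*"
    proof (cases "b = a")
      case True
      then show ?thesis using b(1) by (metis mset_add rtrancl.rtrancl_refl)
    next
      case False
      then have ne: "x \<in> a \<longleftrightarrow> x \<notin> b"
        using b(2) sub by auto
      then have "b2 \<noteq> b" using b2 by auto
      then obtain N0 where N0: "N = {#b, b2#} + N0"
        using b(1) b2(1) two_membersE by metis
      \<comment> \<open>\<open>c\<close> is the other product of the exchange: \<open>b2\<close>
        with the label of \<open>x\<close> taken from \<open>b\<close>.\<close>
      define c where "c = (b2 \<inter> V) \<union> (b \<inter> {x})"
      have eqs: "c \<inter> V = b2 \<inter> V" "c \<inter> insert x S = b \<inter> insert x S"
        using b b2 x S unfolding c_def by auto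
      have "(N, add_mset a (add_mset c N0)) \<in> ?R"
        unfolding steps_def
      proof (clarsimp, intro conjI disjI1)
        show "N \<in> tables (insert x V)" by fact
        then show "a \<subseteq> insert x V" "c \<subseteq> insert x V" "N0 \<in> tables (insert x V)"
          using sub(1) N0 by (auto simp: c_def)
        show "same {V, insert x S} N (add_mset a (add_mset c N0))"
          using N0 b(2) b2(2) eqs by (simp add: same_insert add_mset_commute)
        show "move 2 N (add_mset a (add_mset c N0))"
          unfolding move_def N0
          by (intro exI[of _ "{#b, b2#}"] exI[of _ "{#a, c#}"] exI[of _ N0]) simp
      qed
      then show ?thesis by blast
    qed
    then obtain N' where N': "(N, add_mset a N') \<in> ?R\<^sup>*" by blast
    then have s: "same {V, insert x S} N (add_mset a N')" "add_mset a N' \<in> tables (insert x V)"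
      using steps_rtrancl_same steps_rtrancl_tables add.prems by blast+
    then have "same {V, insert x S} M N'"
      using add.prems(3) same_trans same_add_mset_cancel by blast
    then have "(M, N') \<in> ?R\<^sup>*"
      using add.IH sub s(2) by auto
    from steps_rtrancl_add[OF this, of "{#a#}"] sub(1)
    have "(add_mset a M, add_mset a N') \<in> ?R\<^sup>*" by simp
    then show ?case using N' steps_rtrancl_sym by (metis rtrancl_trans)
  qed
  then show ?thesis unfolding linked_def by blast
qed

text \<open>With all three pair marginals of \<open>{x, p, q}\<close> fixed, the remaining freedom is a multiple
  of the parity vector; flipping \<open>x\<close> in four rows of equal parity changes it by one.\<close>

lemma linked_triangle:
  assumes x: "x \<notin> V" and pq: "p \<in> V" "q \<in> V" "p \<noteq> q" "{p, q} \<in> E" and E: "E \<subseteq> Pow V"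
  shows "linked 4 (insert x V) (E \<union> {{x, p}, {x, q}}) (E \<union> {{x, p, q}})"
proof -
  let ?E = "E \<union> {{x, p}, {x, q}}" and ?F = "E \<union> {{x, p, q}}" and ?V = "insert x V"
  let ?R = "steps 4 ?V ?E ?F"
  have xp: "x \<noteq> p" "x \<noteq> q" using x pq by auto
  define c where "c M s = count (marg {x, p, q} M) s" for M s
  have c_split: "count (marg {p, q} M) {} = c M {} + c M {x}"
      "count (marg {x, p} M) {} = c M {} + c M {q}"
      "count (marg {x, q} M) {} = c M {} + c M {p}"
      "count (marg {x, p} M) {p} = c M {p} + c M {p, q}"
      "count (marg {x, p} M) {x} = c M {x} + c M {x, q}"
      "count (marg {x, q} M) {x} = c M {x} + c M {x, p}"
      "count (marg {x, p} M) {x, p} = c M {x, p} + c M {x, p, q}" for M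
    using count_marg_split[of x "{p, q}" "{}" M] count_marg_split[of q "{x, p}" "{}" M]
      count_marg_split[of p "{x, q}" "{}" M] count_marg_split[of q "{x, p}" "{p}" M]
      count_marg_split[of q "{x, p}" "{x}" M] count_marg_split[of p "{x, q}" "{x}" M]
      count_marg_split[of q "{x, p}" "{x, p}" M] xp pq(3)
    by (simp_all add: c_def insert_commute)
  have *: "(M, N) \<in> ?R\<^sup>*"
    if "M \<in> tables ?V" "N \<in> tables ?V" "same ?E M N" "c M {} = c N {} + d" for M N d
    using that
  proof (induction d arbitrary: M)
    case 0
    have m: "marg {p, q} M = marg {p, q} N" "marg {x, p} M = marg {x, p} N" "marg {x, q} M = marg {x, q} N"
      using 0 pq(4) by (auto simp: same_def)
    have 1: "c M s = c N s" if "s \<subseteq> {p, q}" for s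
    proof -
      have "s \<in> {{}, {p}, {q}, {p, q}}"
        using that by auto
      then show ?thesis
        using 0(4) c_split[of M] c_split[of N] unfolding m by auto
    qed
    have 2: "c M (insert x s) = c N (insert x s)" if "s \<subseteq> {p, q}" for s
      using count_marg_split[of x "{p, q}" s] 1[OF that] that xp m(1) unfolding c_def
      by (metis add_left_cancel insertE singletonD)
    have "c M s = c N s" if "s \<subseteq> {x, p, q}" for s
    proof (cases "x \<in> s")
      case True
      then show ?thesis using 2[of "s - {x}"] that by (simp add: insert_absorb subset_insert_iff)
    next
      case False
      then show ?thesis using 1[of s] that by (simp add: subset_insert)
    qed
    then have "marg {x, p, q} M = marg {x, p, q} N"
      unfolding c_def by (intro marg_eqI) simp
    then have "(M, N) \<in> ?R"
      using 0 by (auto simp: steps_def same_Un same_insert)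
    then show ?case by blast
  next
    case (Suc d)
    have m: "marg {p, q} M = marg {p, q} N" "marg {x, p} M = marg {x, p} N" "marg {x, q} M = marg {x, q} N"
      using Suc.prems pq(4) by (auto simp: same_def)
    \<comment> \<open>Equal pair marginals make the difference of \<open>M\<close> and
      \<open>N\<close> on {x, p, q} a multiple of the parity vector, so all four patterns with an
      even number of ones exceed their count in \<open>N\<close> by \<open>Suc d\<close>.\<close>
    have "c M {} > 0" "c M {x, p} > 0" "c M {x, q} > 0" "c M {p, q} > 0"
      using Suc.prems(4) c_split[of M] c_split[of N] unfolding m by linarith+
    then obtain r0 r1 r2 r3 where r: "r0 \<in># M" "r0 \<inter> {x, p, q} = {}" "r1 \<in># M" "r1 \<inter> {x, p, q} = {x, p}"
      "r2 \<in># M" "r2 \<inter> {x, p, q} = {x, q}" "r3 \<in># M" "r3 \<inter> {x, p, q} = {p, q}"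
      unfolding c_def count_greater_zero_iff by (meson marg_memE)
    then have "r0 \<noteq> r1" "r0 \<noteq> r2" "r0 \<noteq> r3" "r1 \<noteq> r2" "r1 \<noteq> r3" "r2 \<noteq> r3"
      using xp pq(3) by auto
    with r(1,3,5,7) have "{#r0, r1, r2, r3#} \<subseteq># M"
      by (simp add: insert_subset_eq_iff in_diff_count)
    then obtain M0 where M0: "M = {#r0, r1, r2, r3#} + M0"
      using subset_mset.le_iff_add by blast
    have mem: "x \<notin> r0" "p \<notin> r0" "q \<notin> r0" "x \<in> r1" "p \<in> r1" "q \<notin> r1" "x \<in> r2" "p \<notin> r2" "q \<in> r2"
       "x \<notin> r3" "p \<in> r3" "q \<in> r3"
    proof -
      have "y \<in> a \<longleftrightarrow> y \<in> s" if "a \<inter> {x, p, q} = s" "y \<in> {x, p, q}" for a s y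
        using that by auto
      from this[OF r(2)] this[OF r(4)] this[OF r(6)] this[OF r(8)]
      show "x \<notin> r0" "p \<notin> r0" "q \<notin> r0" "x \<in> r1" "p \<in> r1" "q \<notin> r1" "x \<in> r2" "p \<notin> r2" "q \<in> r2"
          "x \<notin> r3" "p \<in> r3" "q \<in> r3"
        using xp pq(3) by simp_all
    qed
    \<comment> \<open>Flipping \<open>x\<close> permutes the four patterns seen on {x, p}, and
      likewise on {x, q}, while sets without \<open>x\<close> do not notice it.\<close>
    define B where "B = {#insert x r0, r1 - {x}, r2 - {x}, insert x r3#}"
    have sE: "same ?E M (B + M0)"
    proof -
      have 1: "insert x r \<inter> e = r \<inter> e" "(r - {x}) \<inter> e = r \<inter> e" if "e \<in> E" for r e
        using that E x by auto
      then have "same E {#r0, r1, r2, r3#} B"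
        by (auto simp: same_def B_def)
      moreover have "marg {x, p} {#r0, r1, r2, r3#} = marg {x, p} B"
        using mem xp by (simp add: B_def add_mset_commute Int_insert_right)
      moreover have "marg {x, q} {#r0, r1, r2, r3#} = marg {x, q} B"
        using mem xp by (simp add: B_def add_mset_commute Int_insert_right)
      ultimately show ?thesis
        unfolding M0 by (simp only: same_add_cancel same_Un same_insert) simp
    qed
    have tab: "B + M0 \<in> tables ?V"
      using Suc.prems(1) by (auto simp: M0 B_def tables_def)
    have "move 4 M (B + M0)"
      unfolding move_def M0
      by (intro exI[of _ "{#r0, r1, r2, r3#}"] exI[of _ B] exI[of _ M0]) (simp add: B_def)
    then have st: "(M, B + M0) \<in> ?R"
      using sE tab Suc.prems(1) by (simp add: steps_def)
    have "c M {} = Suc (c (B + M0) {})"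
      using mem xp by (simp add: M0 B_def c_def Int_insert_right)
    then have "(B + M0, N) \<in> ?R\<^sup>*"
      using Suc.prems sE tab by (intro Suc.IH) (auto intro: same_sym same_trans)
    then show ?case using st by (meson converse_rtrancl_into_rtrancl)
  qed
  show ?thesis
    unfolding linked_def
  proof (intro ballI impI)
    fix M N assume MN: "M \<in> tables ?V" "N \<in> tables ?V" "same ?E M N"
    show "(M, N) \<in> ?R\<^sup>*"
    proof (cases "c M {} \<ge> c N {}")
      case True
      then show ?thesis using *[OF MN] le_iff_add by blast
    next
      case False
      then have "(N, M) \<in> ?R\<^sup>*"
        using *[OF MN(2,1) same_sym[OF MN(3)]] le_iff_add by (metis nat_le_linear)
      then show ?thesis by (rule steps_rtrancl_sym)
    qed
  qed
qed

lemma rtrancl_crossing: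
  assumes "(M, N) \<in> R\<^sup>*" "P M" "\<not> P N"
  obtains W W' where "(M, W) \<in> R\<^sup>*" "(W, W') \<in> R" "P W" "\<not> P W'"
  using assms by (induction rule: rtrancl_induct) blast+

text \<open>A two-by-two table with given row and column sums has a single degree of
  freedom.\<close>

lemma marg_pair_eqI:
  assumes "p \<noteq> q" "marg {p} M = marg {p} N" "marg {q} M = marg {q} N"
    "count (marg {p, q} M) {p, q} = count (marg {p, q} N) {p, q}"
  shows "marg {p, q} M = marg {p, q} N"
proof (rule marg_eqI)
  fix s assume "s \<subseteq> {p, q}"
  then have s: "s \<in> {{}, {p}, {q}, {p, q}}" by auto
  have c: "count (marg {p} M) {} = count (marg {p, q} M) {} + count (marg {p, q} M) {q}"
     "count (marg {p} M) {p} = count (marg {p, q} M) {p} + count (marg {p, q} M) {p, q}"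
     "count (marg {q} M) {q} = count (marg {p, q} M) {q} + count (marg {p, q} M) {p, q}" for M
    using count_marg_split[of q "{p}" "{}" M] count_marg_split[of q "{p}" "{p}" M]
      count_marg_split[of p "{q}" "{q}" M] assms(1)
    by (simp_all add: insert_commute)
  show "count (marg {p, q} M) s = count (marg {p, q} N) s"
    using s c[of M] c[of N] assms by auto
qed

text \<open>Induction on the difference of \<open>t\<close>, the number of rows containing
  \<open>p\<close> and \<open>q\<close>. Each round raises \<open>t M\<close> by one: a move is
  borrowed from the path between the projections to \<open>V\<close>, at the place where this path
  leaves the level \<open>t M\<close>, and is carried out after a jump.\<close>

lemma linked_path:
  assumes l: "linked 2 V E (insert {p, q} E)"
    and x: "x \<notin> V" and pq: "p \<in> V" "q \<in> V" "p \<noteq> q" "{p} \<in> E" "{q} \<in> E" and E: "E \<subseteq> Pow V"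
  shows "linked 2 (insert x V) (E \<union> {{x, p}, {x, q}}) (insert {p, q} (E \<union> {{x, p}, {x, q}}))"
proof -
  let ?E = "E \<union> {{x, p}, {x, q}}" and ?V = "insert x V"
  let ?F = "insert {p, q} ?E"
  let ?R = "steps 2 ?V ?E ?F" and ?T = "{x, p, q}"
  have xp: "x \<noteq> p" "x \<noteq> q" using x pq by auto
  define t where "t M = count (marg {p, q} M) {p, q}" for M
  have pair: "marg {p, q} M = marg {p, q} N" if "same E M N" "t M = t N" for M N
    using that pq by (intro marg_pair_eqI) (auto simp: same_def t_def)
  have c1: "count (marg {p} M) {p} = count (marg {p, q} M) {p} + t M"
     "count (marg {q} M) {q} = count (marg {p, q} M) {q} + t M" for M
    using count_marg_split[of q "{p}" "{p}" M] count_marg_split[of p "{q}" "{q}" M] pq(3)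
    by (simp_all add: t_def insert_commute)
  have c2: "t M = count (marg ?T M) {p, q} + count (marg ?T M) {x, p, q}"
     "count (marg {x, p} M) {p} = count (marg ?T M) {p} + count (marg ?T M) {p, q}"
     "count (marg {x, p} M) {x, p} = count (marg ?T M) {x, p} + count (marg ?T M) {x, p, q}"
     "count (marg {x, q} M) {q} = count (marg ?T M) {q} + count (marg ?T M) {p, q}"
     "count (marg {x, q} M) {x, q} = count (marg ?T M) {x, q} + count (marg ?T M) {x, p, q}" for M
    using count_marg_split[of x "{p, q}" "{p, q}" M] count_marg_split[of q "{x, p}" "{p}" M]
      count_marg_split[of q "{x, p}" "{x, p}" M] count_marg_split[of p "{x, q}" "{q}" M]
      count_marg_split[of p "{x, q}" "{x, q}" M] xp pq(3)
    by (simp_all add: t_def insert_commute)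
  have *: "(M, N) \<in> ?R\<^sup>*"
    if "M \<in> tables ?V" "N \<in> tables ?V" "same ?E M N" "t N = t M + d" for M N d
    using that
  proof (induction d arbitrary: M)
    case 0
    then have "marg {p, q} M = marg {p, q} N"
      by (intro pair) (auto simp: same_def)
    then have "(M, N) \<in> ?R"
      using 0 by (auto simp: steps_def same_Un same_insert)
    then show ?case by blast
  next
    case (Suc d)
    have mxp: "marg {x, p} M = marg {x, p} N" "marg {x, q} M = marg {x, q} N"
      using Suc.prems(3) by (auto simp: same_def)
    \<comment> \<open>\<open>t\<close> is a sum over the two labels of \<open>x\<close>, and one
      summand is larger in \<open>N\<close>. For this label the marginals on {x, p} and {x, q} force
      \<open>M\<close> to have a row with \<open>p\<close> but not \<open>q\<close> and a row with
      \<open>q\<close> but not \<open>p\<close>.\<close>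
    have "\<exists>X\<subseteq>{x}. insert p X \<in># marg ?T M \<and> insert q X \<in># marg ?T M"
    proof (cases "count (marg ?T M) {p, q} < count (marg ?T N) {p, q}")
      case True
      then have "count (marg ?T M) {p} > 0" "count (marg ?T M) {q} > 0"
        using c2[of M] c2[of N] unfolding mxp by linarith+
      then show ?thesis by (intro exI[of _ "{}"]) auto
    next
      case False
      then have "count (marg ?T M) {x, p} > 0" "count (marg ?T M) {x, q} > 0"
        using c2[of M] c2[of N] Suc.prems(4) unfolding mxp by linarith+
      then show ?thesis by (intro exI[of _ "{x}"]) (auto simp: insert_commute)
    qed
    then obtain X r1 r2 where X: "X \<subseteq> {x}" and r: "r1 \<in># M" "r1 \<inter> ?T = insert p X" "r2 \<in># M" "r2 \<inter> ?T = insert q X"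
      by (metis marg_memE)
    have r12: "r1 \<inter> {p, q} = {p}" "r2 \<inter> {p, q} = {q}"
      using r X xp pq(3) by auto
    then have "r1 \<noteq> r2" using pq(3) by auto
    then obtain M0 where M0: "M = {#r1, r2#} + M0"
      using r(1,3) two_membersE by metis

    have tV: "t (marg V L) = t L" for L
      using pq by (simp add: t_def marg_marg_subset)
    have sV: "same E (marg V M) (marg V N)"
      using Suc.prems(3) E unfolding same_def by (metis PowD UnI1 marg_marg_subset subsetD)
    then have path: "(marg V M, marg V N) \<in> (steps 2 V E (insert {p, q} E))\<^sup>*"
      using l by (simp add: linked_def)
    \<comment> \<open>The step across the level changes the {p, q}-marginal, so it cannot be a jump
      and is a move of at most two rows.\<close>
    obtain W W' where W: "(marg V M, W) \<in> (steps 2 V E (insert {p, q} E))\<^sup>*"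
        "(W, W') \<in> steps 2 V E (insert {p, q} E)" "t W \<le> t M" "\<not> t W' \<le> t M"
      by (rule rtrancl_crossing[OF path, of "\<lambda>L. t L \<le> t M"]) (use Suc.prems(4) tV in auto)
    have WV: "W \<in> tables V" "W' \<in> tables V" "same E W W'" and sMW: "same E (marg V M) W"
      using W steps_rtrancl_same by (auto simp: steps_def)
    have "\<not> same (insert {p, q} E) W W'"
      using W(3,4) by (auto simp: same_def t_def)
    then have "move 2 W W'" using W(2) by (auto simp: steps_def)
    then obtain A B C where ABC: "W = A + C" "W' = B + C" "size A \<le> 2" "size B \<le> 2"
      by (auto simp: move_def)
    have sAB: "same E A B" using WV(3) ABC by simp
    then have mAB: "marg {p} A = marg {p} B" "marg {q} A = marg {q} B"
      using pq by (auto simp: same_def)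
    have tAB: "t A < t B" using W(3,4) by (auto simp: ABC t_def)
    \<comment> \<open>\<open>B\<close> has more rows with both \<open>p\<close> and
      \<open>q\<close>, while the marginals at \<open>p\<close> and at \<open>q\<close> are
      unchanged; so \<open>A\<close> has a row with \<open>p\<close> alone and one with
      \<open>q\<close> alone. Being of size at most two, it has no other row, and \<open>t\<close>
      rises by exactly one.\<close>
    then have "count (marg {p, q} A) {p} > 0" "count (marg {p, q} A) {q} > 0"
      using c1[of A] c1[of B] unfolding mAB by linarith+
    then have mem: "{p} \<in># marg {p, q} A" "{q} \<in># marg {p, q} A" by simp_all
    then obtain D where D: "marg {p, q} A = {#{p}, {q}#} + D"
      using pq(3) two_membersE by (metis singleton_inject)
    have "D = {#}" using ABC(3) arg_cong[OF D, of size] by simp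
    then have mA: "marg {p, q} A = {#{p}, {q}#}" using D by simp
    have "t A = 0" using mA pq(3) by (simp add: t_def doubleton_eq_iff)
    moreover have "count (marg {p} A) {p} = 1"
      using c1(1)[of A] mA calculation pq(3) by simp
    then have "t B \<le> 1" using c1(1)[of B] mAB by simp
    ultimately have tW: "t W = t M" "t W' = Suc (t M)"
      using W(3,4) tAB by (auto simp: ABC t_def)
    have "marg {p, q} (marg V M) = marg {p, q} W"
      using pair[OF sMW] tV tW by simp
    then have "marg {p, q} M = marg {p, q} W"
      using pq by (simp add: marg_marg_subset)
    then have "marg {p, q} M0 = marg {p, q} C"
      by (simp add: M0 ABC r12 mA)
    \<comment> \<open>\<open>r1\<close>, \<open>r2\<close> and the rows of \<open>A\<close> look
      alike on {p, q}, and \<open>W\<close> is on the level of \<open>M\<close>. So the remaining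
      rows \<open>M0\<close> and \<open>C\<close> have equal {p, q}-marginals, and \<open>C\<close>
      can inherit the labels of \<open>x\<close> from \<open>M0\<close>.\<close>
    then obtain C' where C': "C' \<in> tables ?V" "marg V C' = C" "marg ?T C' = marg ?T M0"
      using extend_table[of "{p, q}" M0 C V x] WV(1) x pq ABC by auto
    \<comment> \<open>The rows of \<open>A\<close> and \<open>B\<close> all get the common label
      \<open>X\<close> of \<open>r1\<close> and \<open>r2\<close>. Then \<open>K\<close> agrees with
      \<open>M\<close> on {x, p, q}, which makes the passage from \<open>M\<close> to
      \<open>K\<close> a jump; and since the label of \<open>x\<close> is constant on
      \<open>A\<close> and \<open>B\<close>, exchanging them preserves the marginals on {x, p} and
      {x, q}.\<close>
    define lab where "lab = image_mset (\<lambda>a. a \<union> X)"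
    have lab_V: "marg e (lab L) = marg e L" if "e \<subseteq> V" for e L
      unfolding lab_def marg_def multiset.map_comp
      by (rule image_mset_cong) (use that X x in auto)
    have lab_x: "marg (insert x e) (lab L) = image_mset (\<lambda>a. a \<union> X) (marg e L)" if "L \<in> tables V" for e L
      unfolding lab_def marg_def multiset.map_comp
      by (rule image_mset_cong) (use that X x in \<open>auto simp: tables_def\<close>)
    have lab_tables: "lab L \<in> tables ?V" if "L \<in> tables V" for L
      using that X by (auto simp: tables_def lab_def)
    have AB: "A \<in> tables V" "B \<in> tables V" using WV ABC by auto
    define K where "K = lab A + C'"
    define K' where "K' = lab B + C'"
    have K: "K \<in> tables ?V" "K' \<in> tables ?V"
      unfolding K_def K'_def using lab_tables AB C' by auto
    have "marg ?T K = marg ?T M"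
      using r by (simp add: K_def lab_x AB mA C' M0 Un_commute)
    then have KT: "marg e M = marg e K" if "e \<subseteq> ?T" for e
      using that by (metis marg_mono)
    have "marg V K = W"
      using C'(2) AB by (simp add: K_def lab_V marg_id ABC)
    then have "same E M K"
      using sMW E unfolding same_def by (metis PowD marg_marg_subset subsetD)
    then have sMK: "same ?F M K"
      using KT by (auto simp: same_Un same_insert)
    then have 1: "(M, K) \<in> ?R"
      using K Suc.prems(1) by (auto simp: steps_def same_insert)
    have "same ?E (lab A) (lab B)"
      using sAB E mAB lab_V by (auto simp: same_Un same_insert lab_x AB same_def subset_iff)
    then have sKK: "same ?E K K'" by (simp add: K_def K'_def)
    have "move 2 K K'"
      unfolding move_def K_def K'_def
      by (intro exI[of _ "lab A"] exI[of _ "lab B"] exI[of _ C']) (use ABC in \<open>simp add: lab_def\<close>)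
    then have 2: "(K, K') \<in> ?R" using K sKK by (simp add: steps_def)
    have "t K' = t (marg V K')" by (simp add: tV)
    also have "marg V K' = W'"
      using C'(2) AB by (simp add: K'_def lab_V marg_id ABC)
    finally have tK': "t K' = Suc (t M)" using tW by simp
    have "same ?E K' N"
      using sKK sMK Suc.prems(3) by (meson same_insert same_sym same_trans)
    then have "(K', N) \<in> ?R\<^sup>*"
      using K(2) Suc.prems(2,4) tK' by (intro Suc.IH) auto
    then show ?case using 1 2 by (meson converse_rtrancl_into_rtrancl)
  qed
  show ?thesis
    unfolding linked_def
  proof (intro ballI impI)
    fix M N assume MN: "M \<in> tables ?V" "N \<in> tables ?V" "same ?E M N"
    show "(M, N) \<in> ?R\<^sup>*"
    proof (cases "t N \<ge> t M")
      case True
      then show ?thesis using *[OF MN] le_iff_add by blast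
    next
      case False
      then have "(N, M) \<in> ?R\<^sup>*"
        using *[OF MN(2,1) same_sym[OF MN(3)]] le_iff_add by (metis nat_le_linear)
      then show ?thesis by (rule steps_rtrancl_sym)
    qed
  qed
qed

section \<open>Minors and contraction\<close>

definition nbrs :: "'a ugraph \<Rightarrow> 'a \<Rightarrow> 'a set" where
  "nbrs G x = {v. {x, v} \<in> edges G}"

definition del_vertex :: "'a ugraph \<Rightarrow> 'a \<Rightarrow> 'a ugraph" where
  "del_vertex G x = (verts G - {x}, {e \<in> edges G. x \<notin> e})"

definition add_edge :: "'a ugraph \<Rightarrow> 'a \<Rightarrow> 'a \<Rightarrow> 'a ugraph" where
  "add_edge G p q = (verts G, insert {p, q} (edges G))"

definition contract :: "'a ugraph \<Rightarrow> 'a \<Rightarrow> 'a \<Rightarrow> 'a ugraph" where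
  "contract G x z = (verts G - {x}, {e \<in> edges G. x \<notin> e} \<union> {{z, v} |v. v \<in> nbrs G x \<and> v \<noteq> z})"

lemma mem_nbrs: "v \<in> nbrs G x \<longleftrightarrow> {x, v} \<in> edges G"
  by (simp add: nbrs_def)

lemma nbrs_sym: "v \<in> nbrs G x \<longleftrightarrow> x \<in> nbrs G v"
  by (simp add: nbrs_def insert_commute)

lemma
  assumes "finite_simple_graph G" "{x, y} \<in> edges G"
  shows edge_in_verts: "x \<in> verts G" "y \<in> verts G" and edge_neq: "x \<noteq> y"
proof -
  have "{x, y} \<subseteq> verts G" "card {x, y} = 2"
    using assms unfolding finite_simple_graph_def by blast+
  then show "x \<in> verts G" "y \<in> verts G" "x \<noteq> y"
    by auto
qed

lemma nbrs_subset: "finite_simple_graph G \<Longrightarrow> nbrs G x \<subseteq> verts G - {x}"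
  unfolding nbrs_def by (auto dest: edge_in_verts edge_neq)

lemma finite_nbrs: "finite_simple_graph G \<Longrightarrow> finite (nbrs G x)"
  using finite_subset[OF nbrs_subset[of G x]] by (simp add: finite_simple_graph_def)

lemma edgeE:
  assumes "finite_simple_graph G" "e \<in> edges G"
  obtains u v where "e = {u, v}" "u \<noteq> v" "u \<in> verts G" "v \<in> verts G"
proof -
  have "e \<subseteq> verts G" "card e = 2" using assms unfolding finite_simple_graph_def by blast+
  then show ?thesis using that unfolding card_2_iff by auto
qed

lemma simple_del_vertex: "finite_simple_graph G \<Longrightarrow> finite_simple_graph (del_vertex G x)"
  unfolding finite_simple_graph_def del_vertex_def by auto

lemma simple_add_edge:
  "finite_simple_graph G \<Longrightarrow> p \<in> verts G \<Longrightarrow> q \<in> verts G \<Longrightarrow> p \<noteq> q \<Longrightarrow> finite_simple_graph (add_edge G p q)"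
  unfolding finite_simple_graph_def add_edge_def by auto

lemma simple_contract:
  assumes "finite_simple_graph G" "{x, z} \<in> edges G"
  shows "finite_simple_graph (contract G x z)"
proof -
  have "x \<noteq> z" "z \<in> verts G" using assms edge_in_verts edge_neq by metis+
  then show ?thesis
    using assms(1) nbrs_subset[OF assms(1), of x]
    unfolding finite_simple_graph_def contract_def by auto
qed

definition adj_in :: "'a ugraph \<Rightarrow> 'a set \<Rightarrow> 'a rel" where
  "adj_in G S = {(u, v). u \<in> S \<and> v \<in> S \<and> {u, v} \<in> edges G}"

lemma connected_in_alt: "connected_in G S \<longleftrightarrow> S \<noteq> {} \<and> (\<forall>x\<in>S. \<forall>y\<in>S. (x, y) \<in> (adj_in G S)\<^sup>*)"
  by (simp add: connected_in_def adj_in_def)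

lemma sym_adj_in: "sym (adj_in G S)"
  by (auto simp: adj_in_def sym_def insert_commute)

lemma connected_inI:
  assumes "c \<in> S" "\<And>y. y \<in> S \<Longrightarrow> (c, y) \<in> (adj_in G S)\<^sup>*"
  shows "connected_in G S"
  unfolding connected_in_alt
proof (intro conjI ballI)
  fix x y assume "x \<in> S" "y \<in> S"
  then have "(x, c) \<in> (adj_in G S)\<^sup>*" "(c, y) \<in> (adj_in G S)\<^sup>*"
    using assms(2) sym_rtrancl[OF sym_adj_in[of G S]] by (auto dest: symD)
  then show "(x, y) \<in> (adj_in G S)\<^sup>*" by simp
qed (use assms in auto)

lemma connected_singleton: "connected_in G {x}"
  by (rule connected_inI[of x]) auto

lemma is_minor_mono:
  assumes "is_minor H G" "verts G \<subseteq> verts G'" "edges G \<subseteq> edges G'"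
  shows "is_minor H G'"
proof -
  have con: "connected_in G S \<Longrightarrow> connected_in G' S" for S
  proof -
    have "adj_in G S \<subseteq> adj_in G' S" using assms(3) by (auto simp: adj_in_def)
    then show "connected_in G S \<Longrightarrow> connected_in G' S"
      unfolding connected_in_alt using rtrancl_mono by blast
  qed
  obtain Br where Br: "\<forall>x\<in>verts H. Br x \<subseteq> verts G \<and> connected_in G (Br x)"
      "disjoint_family_on Br (verts H)"
      "\<forall>x y. {x, y} \<in> edges H \<longrightarrow> (\<exists>u\<in>Br x. \<exists>v\<in>Br y. {u, v} \<in> edges G)"
    using assms(1) unfolding is_minor_def by blast
  show ?thesis
    unfolding is_minor_def
  proof (intro exI[of _ Br] conjI)
    show "\<forall>x\<in>verts H. Br x \<subseteq> verts G' \<and> connected_in G' (Br x)"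
      using Br(1) con assms(2) by blast
    show "\<forall>x y. {x, y} \<in> edges H \<longrightarrow> (\<exists>u\<in>Br x. \<exists>v\<in>Br y. {u, v} \<in> edges G')"
      using Br(3) assms(3) by blast
  qed (rule Br(2))
qed

text \<open>The branch set containing \<open>z\<close>, if there is one, also receives
  \<open>x\<close>. An edge at \<open>z\<close> that comes from \<open>x\<close> is replaced by the
  detour through \<open>x\<close>.\<close>

lemma is_minor_contract:
  assumes m: "is_minor H (contract G x z)" and G: "finite_simple_graph G" and xz: "{x, z} \<in> edges G"
  shows "is_minor H G"
proof -
  let ?C = "contract G x z"
  obtain Br where Br: "\<And>i. i \<in> verts H \<Longrightarrow> Br i \<subseteq> verts ?C \<and> connected_in ?C (Br i)"
      "disjoint_family_on Br (verts H)"
      "\<And>i j. {i, j} \<in> edges H \<Longrightarrow> \<exists>u\<in>Br i. \<exists>v\<in>Br j. {u, v} \<in> edges ?C"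
    using m unfolding is_minor_def by metis
  have xV: "x \<in> verts G" "x \<noteq> z" using edge_in_verts edge_neq G xz by metis+
  have edge: "{u, v} \<in> edges G \<or> (u = z \<and> {x, v} \<in> edges G) \<or> (v = z \<and> {x, u} \<in> edges G)"
    if "{u, v} \<in> edges ?C" for u v
    using that by (auto simp: contract_def mem_nbrs doubleton_eq_iff)
  define B where "B i = (if z \<in> Br i then insert x (Br i) else Br i)" for i
  have "connected_in G (B i)" if i: "i \<in> verts H" for i
  proof (cases "z \<in> Br i")
    case False
    then have "adj_in ?C (Br i) \<subseteq> adj_in G (Br i)"
      using edge by (auto simp: adj_in_def)
    then have "(adj_in ?C (Br i))\<^sup>* \<subseteq> (adj_in G (Br i))\<^sup>*" by (rule rtrancl_mono)
    moreover have "B i = Br i" using False by (simp add: B_def)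
    ultimately show ?thesis
      using Br(1)[OF i] by (simp add: connected_in_alt subset_iff)
  next
    case True
    have zx: "(z, x) \<in> adj_in G (B i)" "(x, z) \<in> adj_in G (B i)"
      using True xz by (auto simp: adj_in_def B_def insert_commute)
    have "adj_in ?C (Br i) \<subseteq> (adj_in G (B i))\<^sup>*"
    proof clarify
      fix u v assume uv: "(u, v) \<in> adj_in ?C (Br i)"
      then consider "{u, v} \<in> edges G" | "u = z" "{x, v} \<in> edges G" | "v = z" "{x, u} \<in> edges G"
        using edge by (auto simp: adj_in_def)
      then show "(u, v) \<in> (adj_in G (B i))\<^sup>*"
      proof cases
        case 1
        then show ?thesis using uv by (auto simp: adj_in_def B_def)
      next
        case 2
        then have "(x, v) \<in> adj_in G (B i)" using uv True by (auto simp: adj_in_def B_def)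
        then show ?thesis using zx 2 by (meson converse_rtrancl_into_rtrancl r_into_rtrancl)
      next
        case 3
        then have "(u, x) \<in> adj_in G (B i)" using uv True by (auto simp: adj_in_def B_def insert_commute)
        then show ?thesis using zx 3 by (meson converse_rtrancl_into_rtrancl r_into_rtrancl)
      qed
    qed
    then have sub: "(adj_in ?C (Br i))\<^sup>* \<subseteq> (adj_in G (B i))\<^sup>*"
      by (metis rtrancl_idemp rtrancl_mono)
    show ?thesis
    proof (rule connected_inI[of z])
      show "z \<in> B i" using True by (simp add: B_def)
      fix y assume "y \<in> B i"
      then consider "y = x" | "y \<in> Br i" using True by (auto simp: B_def)
      then show "(z, y) \<in> (adj_in G (B i))\<^sup>*"
        using zx sub Br(1)[OF i] True unfolding connected_in_alt by cases auto
    qed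
  qed
  moreover have "B i \<subseteq> verts G" if "i \<in> verts H" for i
    using Br(1)[OF that] xV by (auto simp: B_def contract_def)
  moreover have "disjoint_family_on B (verts H)"
  proof -
    have "x \<notin> Br i" if "i \<in> verts H" for i
      using Br(1)[OF that] by (auto simp: contract_def)
    then show ?thesis
      using Br(2) unfolding disjoint_family_on_def B_def by auto
  qed
  moreover have "\<exists>u\<in>B i. \<exists>v\<in>B j. {u, v} \<in> edges G" if ij: "{i, j} \<in> edges H" for i j
  proof -
    obtain u v where uv: "u \<in> Br i" "v \<in> Br j" "{u, v} \<in> edges ?C" using Br(3)[OF ij] by blast
    from edge[OF uv(3)] show ?thesis
    proof (elim disjE conjE)
      assume "{u, v} \<in> edges G"
      then show ?thesis using uv unfolding B_def by (metis insertCI)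
    next
      assume "u = z" "{x, v} \<in> edges G"
      then show ?thesis using uv unfolding B_def by (metis insertCI)
    next
      assume "v = z" "{x, u} \<in> edges G"
      then show ?thesis using uv unfolding B_def by (metis insertCI insert_commute)
    qed
  qed
  ultimately show ?thesis unfolding is_minor_def by (intro exI[of _ B]) auto
qed

lemma K4_minorI:
  assumes "\<And>S. S \<in> {A, B, C, D} \<Longrightarrow> S \<subseteq> verts G \<and> connected_in G S"
    and "A \<inter> B = {}" "A \<inter> C = {}" "A \<inter> D = {}" "B \<inter> C = {}" "B \<inter> D = {}" "C \<inter> D = {}"
    and e: "\<exists>u\<in>A. \<exists>v\<in>B. {u, v} \<in> edges G" "\<exists>u\<in>A. \<exists>v\<in>C. {u, v} \<in> edges G"
      "\<exists>u\<in>A. \<exists>v\<in>D. {u, v} \<in> edges G" "\<exists>u\<in>B. \<exists>v\<in>C. {u, v} \<in> edges G"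
      "\<exists>u\<in>B. \<exists>v\<in>D. {u, v} \<in> edges G" "\<exists>u\<in>C. \<exists>v\<in>D. {u, v} \<in> edges G"
  shows "is_minor (complete_ugraph 4) G"
proof -
  define Br where "Br i = (if i = 0 then A else if i = 1 then B else if i = 2 then C else D)" for i :: nat
  have lt4: "i < 4 \<longleftrightarrow> i = 0 \<or> i = 1 \<or> i = 2 \<or> i = 3" for i :: nat by auto
  have "\<exists>u\<in>Br i. \<exists>v\<in>Br j. {u, v} \<in> edges G" if "{i, j} \<in> edges (complete_ugraph 4)" for i j
  proof -
    have "i < 4" "j < 4" "i \<noteq> j" using that by (auto simp: complete_ugraph_def)
    then have ij: "i \<in> {0, 1, 2, 3}" "j \<in> {0, 1, 2, 3}" "i \<noteq> j" by auto
    have s: "\<exists>u\<in>S. \<exists>v\<in>T. {u, v} \<in> edges G" if "\<exists>u\<in>T. \<exists>v\<in>S. {u, v} \<in> edges G" for S T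
      using that by (metis insert_commute)
    show ?thesis
      using ij e e[THEN s] by (auto simp: Br_def)
  qed
  moreover have "disjoint_family_on Br (verts (complete_ugraph 4))"
    using assms(2-7) unfolding disjoint_family_on_def complete_ugraph_def by (auto simp: Br_def)
  moreover have "\<forall>i\<in>verts (complete_ugraph 4). Br i \<subseteq> verts G \<and> connected_in G (Br i)"
    using assms(1) by (auto simp: Br_def)
  ultimately show ?thesis unfolding is_minor_def by (intro exI[of _ Br]) auto
qed

lemma K4_subgraph:
  assumes G: "finite_simple_graph G"
    and "{a, b} \<in> edges G" "{a, c} \<in> edges G" "{a, d} \<in> edges G"
      "{b, c} \<in> edges G" "{b, d} \<in> edges G" "{c, d} \<in> edges G"
  shows "is_minor (complete_ugraph 4) G"
proof (rule K4_minorI[of "{a}" "{b}" "{c}" "{d}"])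
  show "{a} \<inter> {b} = {}" "{a} \<inter> {c} = {}" "{a} \<inter> {d} = {}" "{b} \<inter> {c} = {}" "{b} \<inter> {d} = {}" "{c} \<inter> {d} = {}"
    using assms edge_neq[OF G] by (auto simp del: insert_iff)
  show "S \<subseteq> verts G \<and> connected_in G S" if "S \<in> {{a}, {b}, {c}, {d}}" for S
    using that edge_in_verts[OF G assms(2)] edge_in_verts[OF G assms(7)] connected_singleton[of G] by auto
qed (use assms in auto)

section \<open>Degrees after contracting an edge\<close>

lemma nbrs_contract:
  assumes "w \<noteq> x" "x \<noteq> z"
  shows "nbrs (contract G x z) w =
    (if w = z then (nbrs G z - {x}) \<union> (nbrs G x - {z})
     else if x \<in> nbrs G w then insert z (nbrs G w - {x}) else nbrs G w)"
  using assms unfolding nbrs_def contract_def by (auto simp: doubleton_eq_iff insert_commute)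

text \<open>A vertex other than \<open>z\<close> loses degree only when \<open>x\<close> and
  \<open>z\<close> merge in its neighborhood, and then loses one. The merged vertex keeps all outer
  neighbors of \<open>x\<close> and of \<open>z\<close>, at least two of each, so it has degree two
  only if these two sets coincide. No degree bound is assumed on \<open>R\<close>, which will be the
  prescribed edge.\<close>

lemma contract_low_degree:
  assumes G: "finite_simple_graph G" and xz: "{x, z} \<in> edges G"
    and deg: "\<And>v. v \<in> verts G \<Longrightarrow> v \<notin> R \<Longrightarrow> 3 \<le> card (nbrs G v)" and "x \<notin> R"
    and w: "w \<in> verts G" "w \<notin> R" "w \<noteq> x" "card (nbrs (contract G x z) w) \<le> 2"
  shows "(w \<noteq> z \<and> x \<in> nbrs G w \<and> z \<in> nbrs G w \<and> card (nbrs G w) = 3) \<or>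
    (z \<notin> R \<and> card (nbrs G x) = 3 \<and> insert x (nbrs G x) = insert z (nbrs G z))"
proof -
  note fin = finite_nbrs[OF G]
  have xz': "x \<noteq> z" "x \<in> verts G" using edge_neq edge_in_verts G xz by metis+
  have w3: "3 \<le> card (nbrs G w)" using deg w by blast
  show ?thesis
  proof (cases "w = z")
    case False
    then have x: "x \<in> nbrs G w"
      using w w3 xz' by (auto simp: nbrs_contract split: if_splits)
    then have "card (nbrs G w) = Suc (card (nbrs G w - {x}))"
      using fin by (metis card_Suc_Diff1)
    moreover have "card (insert z (nbrs G w - {x})) \<le> 2"
      using w False x xz' by (simp add: nbrs_contract)
    ultimately show ?thesis
      using w3 False x xz' fin by (auto simp: card_insert_if split: if_splits)
  next
    case True
    let ?A = "nbrs G z - {x}" and ?B = "nbrs G x - {z}"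
    have "card (?A \<union> ?B) \<le> 2" using w True xz' by (simp add: nbrs_contract)
    moreover have "x \<in> nbrs G z" "z \<in> nbrs G x" using xz by (auto simp: nbrs_def insert_commute)
    then have "2 \<le> card ?A" "2 \<le> card ?B" "card (nbrs G x) = Suc (card ?B)"
      using w3 True deg[OF xz'(2) assms(4)] fin by (auto simp: card_Diff_singleton_if intro: card_Suc_Diff1[symmetric])
    moreover have "card ?A \<le> card (?A \<union> ?B)" "card ?B \<le> card (?A \<union> ?B)"
      using fin by (auto intro: card_mono)
    ultimately have "card ?A = 2" "card ?B = 2" "card (?A \<union> ?B) = 2" by linarith+
    moreover from this have "?A = ?A \<union> ?B"
      using fin by (intro card_subset_eq) auto
    moreover have "?B = ?A \<union> ?B"
      using fin calculation by (intro card_subset_eq) auto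
    ultimately have "?A = ?B" "card ?B = 2" by blast+
    moreover have "nbrs G x = insert z ?B" "nbrs G z = insert x ?A"
      using \<open>x \<in> nbrs G z\<close> \<open>z \<in> nbrs G x\<close> by blast+
    ultimately have "insert x (nbrs G x) = insert z (nbrs G z)"
      by (metis insert_commute)
    then show ?thesis
      using True w \<open>card (nbrs G x) = Suc (card ?B)\<close> \<open>card ?B = 2\<close> by simp
  qed
qed

section \<open>Vertices of low degree\<close>

lemma card_3_obtain_third:
  assumes "card S = 3" "x \<in> S" "z \<in> S" "x \<noteq> z"
  obtains u where "S = {x, z, u}" "u \<noteq> x" "u \<noteq> z"
proof -
  have "card (S - {x, z}) = 1"
    using assms by (simp add: card_Diff_subset)
  then obtain u where "S - {x, z} = {u}" by (meson card_1_singletonE)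
  then show ?thesis using assms by (intro that[of u]) blast+
qed

lemma card_3_obtain_others:
  assumes "card S = 3" "z \<in> S"
  obtains a b where "S = {z, a, b}" "a \<noteq> z" "b \<noteq> z" "a \<noteq> b"
proof -
  have "card (S - {z}) = 2"
    using assms by (simp add: card_Diff_singleton)
  then obtain a b where ab: "S - {z} = {a, b}" "a \<noteq> b" by (auto simp: card_2_iff)
  then have "a \<in> S - {z}" "b \<in> S - {z}" by simp_all
  moreover have "S = insert z (S - {z})" using assms(2) by blast
  ultimately show ?thesis using ab by (intro that[of a b]) auto
qed

text \<open>The subgraph induced on \<open>C\<close> is a smaller counterexample: all vertices of
  \<open>C\<close> except \<open>u\<close> keep their neighbors, and \<open>u\<close> keeps at least
  one neighbor \<open>u'\<close> because \<open>w\<close> and \<open>x\<close> account for at most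
  two. The edge from \<open>u\<close> to \<open>u'\<close> serves as the prescribed edge, so the
  loss of degree at \<open>u\<close> does no harm.\<close>

lemma no_K4_side:
  fixes G :: "'a ugraph"
  assumes IH: "\<And>(G' :: 'a ugraph) r s. \<lbrakk>card (verts G') < card (verts G); finite_simple_graph G'; {r, s} \<in> edges G';
        3 \<le> card (verts G'); \<not> is_minor (complete_ugraph 4) G'\<rbrakk>
      \<Longrightarrow> \<exists>v\<in>verts G' - {r, s}. card (nbrs G' v) \<le> 2"
    and G: "finite_simple_graph G" and K4: "\<not> is_minor (complete_ugraph 4) G"
    and deg: "\<And>v. v \<in> C \<Longrightarrow> 3 \<le> card (nbrs G v)"
    and C: "C \<subseteq> verts G" "u \<in> C" "C \<noteq> verts G"
      "nbrs G u \<subseteq> C \<union> {w, x}" "\<And>v. v \<in> C \<Longrightarrow> v \<noteq> u \<Longrightarrow> nbrs G v \<subseteq> C"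
  shows False
proof -
  have finV: "finite (verts G)" using G by (simp add: finite_simple_graph_def)
  then have finC: "finite C" using C(1) finite_subset by blast
  have "\<not> nbrs G u \<subseteq> {w, x}"
  proof
    assume "nbrs G u \<subseteq> {w, x}"
    then have "card (nbrs G u) \<le> card {w, x}" by (intro card_mono) auto
    also have "\<dots> \<le> 2" by (simp add: card_insert_if)
    finally show False using deg[OF C(2)] by simp
  qed
  then obtain u' where u': "u' \<in> nbrs G u" "u' \<in> C" using C(4) by blast
  then have ne: "u' \<noteq> u" "{u, u'} \<in> edges G" using nbrs_subset[OF G] by (auto simp: nbrs_def)
  define G' where "G' = (C, {e \<in> edges G. e \<subseteq> C})"
  have "card (nbrs G u') \<le> card C" using C(5) u' ne finC by (intro card_mono) auto
  then have "3 \<le> card C" using deg[OF u'(2)] by simp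
  moreover have "card C < card (verts G)" using C finV by (intro psubset_card_mono) auto
  moreover have "finite_simple_graph G'" using G finC by (auto simp: G'_def finite_simple_graph_def)
  moreover have "\<not> is_minor (complete_ugraph 4) G'"
    using K4 is_minor_mono[of "complete_ugraph 4" G' G] C(1) by (auto simp: G'_def)
  ultimately obtain v where v: "v \<in> C" "v \<noteq> u" "card (nbrs G' v) \<le> 2"
    using IH[of G' u u'] ne u' C by (auto simp: G'_def)
  have "nbrs G' v = nbrs G v"
    using C(5)[OF v(1,2)] v(1) by (auto simp: G'_def nbrs_def)
  then show False using deg[OF v(1)] v(3) by simp
qed

text \<open>Minimal counterexample: contracting an edge at a vertex outside \<open>{r, s}\<close> must create a vertex
  of degree two, so the edge lies in a triangle. Iterating gives two adjacent vertices \<open>w\<close>, \<open>x\<close> of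
  degree three with the same two further neighbours \<open>z\<close>, \<open>u\<close>. Either \<open>z\<close> and \<open>u\<close> are connected
  avoiding \<open>w\<close>, \<open>x\<close>, or the side of \<open>{w, x}\<close> that misses \<open>{r, s}\<close> is a smaller counterexample.\<close>

lemma low_degree_vertex_of_K4_minor_free:
  assumes "finite_simple_graph G" "{r, s} \<in> edges G" "3 \<le> card (verts G)"
    "\<not> is_minor (complete_ugraph 4) G"
  shows "\<exists>x\<in>verts G - {r, s}. card (nbrs G x) \<le> 2"
  using assms
proof (induction "card (verts G)" arbitrary: G r s rule: less_induct)
  case less
  note G = less.prems(1) and rs = less.prems(2) and K4 = less.prems(4)
  have finV: "finite (verts G)" using G by (simp add: finite_simple_graph_def)
  show ?case
  proof (rule ccontr)
    assume "\<not> ?thesis"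
    then have deg: "3 \<le> card (nbrs G v)" if "v \<in> verts G" "v \<notin> {r, s}" for v
      using that by force
    have noK4: False if "{a, b} \<in> edges G" "{a, c} \<in> edges G" "{a, d} \<in> edges G"
      "{b, c} \<in> edges G" "{b, d} \<in> edges G" "{c, d} \<in> edges G" for a b c d
      using K4_subgraph[OF G that] K4 by blast
    have contr: "(\<exists>w. w \<in> verts G \<and> w \<notin> {r, s} \<and> x \<in> nbrs G w \<and> z \<in> nbrs G w \<and> card (nbrs G w) = 3) \<or>
        (z \<notin> {r, s} \<and> card (nbrs G x) = 3 \<and> insert x (nbrs G x) = insert z (nbrs G z))"
      if xz: "{x, z} \<in> edges G" and x: "x \<notin> {r, s}" for x z
    proof -
      let ?C = "contract G x z"
      have xV: "x \<in> verts G" "z \<in> verts G" "x \<noteq> z" using edge_in_verts edge_neq G xz by metis+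
      \<comment> \<open>Degree three at \<open>x\<close> gives at least four vertices, so the
        contracted graph still has the three vertices that the induction hypothesis demands.\<close>
      have "card (nbrs G x) \<le> card (verts G - {x})"
        using nbrs_subset[OF G] finV by (intro card_mono) auto
      then have "4 \<le> card (verts G)"
        using deg[OF xV(1) x] xV(1) finV by (simp add: card_Diff_singleton_if)
      moreover have "verts ?C = verts G - {x}" by (simp add: contract_def)
      ultimately have "card (verts ?C) < card (verts G)" "3 \<le> card (verts ?C)"
        using xV(1) finV by (simp_all add: card_Diff_singleton_if)
      moreover have "{r, s} \<in> edges ?C" using rs x by (auto simp: contract_def)
      moreover have "\<not> is_minor (complete_ugraph 4) ?C"
        using is_minor_contract[OF _ G xz] K4 by blast
      ultimately obtain w where w: "w \<in> verts ?C - {r, s}" "card (nbrs ?C w) \<le> 2"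
        using less.hyps[of ?C r s] simple_contract[OF G xz] by blast
      then have "w \<in> verts G" "w \<notin> {r, s}" "w \<noteq> x" by (auto simp: contract_def)
      with contract_low_degree[OF G xz, of "{r, s}" w] deg x w(2) show ?thesis by blast
    qed
    have e_sym: "{a, b} \<in> edges G \<longleftrightarrow> {b, a} \<in> edges G" for a b by (simp add: insert_commute)

    \<comment> \<open>A vertex of degree three outside {r, s} on a triangle. If contracting xz only
      shows that \<open>x\<close> and \<open>z\<close> have the same closed neighborhood {x, z, a,
      b}, the edge xa is contracted instead; the same outcome for \<open>x\<close> and
      \<open>a\<close> would make \<open>a\<close> and \<open>b\<close> adjacent and {x, z, a, b}
      complete.\<close>
    have "\<exists>w x z u. w \<in> verts G \<and> w \<notin> {r, s} \<and> nbrs G w = {x, z, u} \<and> x \<noteq> z \<and> u \<noteq> x \<and> u \<noteq> z \<and> {x, z} \<in> edges G"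
    proof -
      have tri: ?thesis if t: "w \<in> verts G" "w \<notin> {r, s}" "x \<in> nbrs G w" "z \<in> nbrs G w" "card (nbrs G w) = 3"
        "{x, z} \<in> edges G" for w x z
      proof -
        have "x \<noteq> z" using edge_neq[OF G t(6)] .
        then obtain u where "nbrs G w = {x, z, u}" "u \<noteq> x" "u \<noteq> z"
          using card_3_obtain_third[OF t(5,3,4)] by blast
        then show ?thesis using t \<open>x \<noteq> z\<close> by blast
      qed
      have "\<not> verts G \<subseteq> {r, s}"
      proof
        assume "verts G \<subseteq> {r, s}"
        then have "card (verts G) \<le> card {r, s}" by (intro card_mono) auto
        then show False using less.prems(3) by (simp add: card_insert_if split: if_splits)
      qed
      then obtain x where x: "x \<in> verts G" "x \<notin> {r, s}" by blast
      then have "nbrs G x \<noteq> {}" using deg by force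
      then obtain z where xz: "{x, z} \<in> edges G" by (auto simp: nbrs_def)
      then have xz': "x \<noteq> z" using edge_neq[OF G] by blast
      from contr[OF xz x(2)] show ?thesis
      proof (elim disjE exE conjE)
        assume N: "card (nbrs G x) = 3" "insert x (nbrs G x) = insert z (nbrs G z)"
        have "z \<in> nbrs G x" using xz by (simp add: mem_nbrs)
        with N(1) obtain a b where ab: "nbrs G x = {z, a, b}" "a \<noteq> z" "b \<noteq> z" "a \<noteq> b"
          by (rule card_3_obtain_others)
        have xa: "{x, a} \<in> edges G" "{x, b} \<in> edges G" using ab(1) by (auto simp: mem_nbrs[symmetric])
        then have "a \<noteq> x" "b \<noteq> x" using edge_neq[OF G] by blast+
        then have za: "{z, a} \<in> edges G" "{z, b} \<in> edges G"
          using N(2) ab by (auto simp: mem_nbrs[symmetric])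
        from contr[OF xa(1) x(2)] show ?thesis
        proof (elim disjE exE conjE)
          assume "insert x (nbrs G x) = insert a (nbrs G a)"
          then have "{a, b} \<in> edges G" using ab by (auto simp: mem_nbrs[symmetric])
          then show ?thesis using noK4[of x z a b] xz xa za by blast
        qed (use tri xa in blast)
      qed (use tri xz in blast)
    qed
    then obtain w x0 z0 u where w: "w \<in> verts G" "w \<notin> {r, s}" "nbrs G w = {x0, z0, u}" "x0 \<noteq> z0" "u \<noteq> x0" "u \<noteq> z0"
      "{x0, z0} \<in> edges G" by blast
    have wu: "{w, u} \<in> edges G" and wxz: "{w, x0} \<in> edges G" "{w, z0} \<in> edges G"
      using w(3) by (auto simp: mem_nbrs[symmetric])
    have w_ne: "w \<notin> {x0, z0, u}" using nbrs_subset[OF G, of w] w(3) by blast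
    \<comment> \<open>Contraction of the third edge wu at \<open>w\<close>: a common neighbor of
      \<open>w\<close> and \<open>u\<close> can only be \<open>x0\<close> or \<open>z0\<close>,
      whereas coinciding closed neighborhoods would make {w, x0, z0, u} complete.\<close>
    obtain x z where xz: "{x, z} = {x0, z0}" "x \<noteq> z" "x \<in> verts G" "x \<notin> {r, s}" "nbrs G x = {w, z, u}"
    proof -
      from contr[OF wu w(2)] show ?thesis
      proof (elim disjE exE conjE)
        fix x assume x: "x \<in> verts G" "x \<notin> {r, s}" "w \<in> nbrs G x" "u \<in> nbrs G x" "card (nbrs G x) = 3"
        then have "x \<in> {x0, z0, u}" "x \<noteq> u"
          using w(3) nbrs_subset[OF G, of x] by (auto simp: nbrs_sym[of x])
        then obtain z where z: "{x, z} = {x0, z0}" "x \<noteq> z" using w(4) by blast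
        then have "z \<in> nbrs G x"
          using w(7) by (metis mem_nbrs)
        moreover have "w \<noteq> u" "z \<noteq> w" "z \<noteq> u"
          using w_ne z w(4-6) by (auto simp: doubleton_eq_iff)
        ultimately have "nbrs G x = {w, z, u}"
          using card_3_obtain_third[OF x(5,3,4)] by (metis insertE insert_commute singletonD)
        then show ?thesis using that z x by blast
      next
        assume "insert w (nbrs G w) = insert u (nbrs G u)"
        then have "{u, x0} \<in> edges G" "{u, z0} \<in> edges G"
          using w(3-6) by (auto simp: mem_nbrs[symmetric])
        then have False using noK4[of w x0 z0 u] wu wxz w(7) e_sym by blast
        then show ?thesis ..
      qed
    qed
    have wN: "nbrs G w = {x, z, u}" using w(3) xz(1) by auto
    have zu: "z \<noteq> u" using xz(1,2) w(4-6) by (auto simp: doubleton_eq_iff)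
    have wx: "{w, x} \<in> edges G" "{w, z} \<in> edges G" "{x, z} \<in> edges G" "{x, u} \<in> edges G"
      using wN xz(5) by (auto simp: mem_nbrs[symmetric])
    have ne: "w \<noteq> x" "w \<noteq> z" "x \<noteq> u" "w \<noteq> u"
      using wx wu edge_neq[OF G] by blast+
    have zV: "z \<in> verts G" "u \<in> verts G" using wx wu edge_in_verts[OF G] by blast+
    define S where "S = verts G - {w, x, z}"
    \<comment> \<open>The component of \<open>u\<close> after deleting \<open>w\<close>,
      \<open>x\<close>, \<open>z\<close>. A neighbor of \<open>z\<close> in it would make {w}, {x},
      {z}, \<open>C\<close> the branch sets of a \<open>K\<^sub>4\<close>-minor. Hence {w, x}
      separates \<open>C\<close> from the remaining vertices \<open>D\<close>, and \<open>z\<close>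
      lies in \<open>D\<close>.\<close>
    define C where "C = {v. (u, v) \<in> (adj_in G S)\<^sup>*}"
    have uC: "u \<in> C" by (simp add: C_def)
    have CS: "C \<subseteq> S"
    proof
      fix v assume "v \<in> C"
      then have "(u, v) \<in> (adj_in G S)\<^sup>*" by (simp add: C_def)
      then show "v \<in> S" using zV zu ne by (cases rule: rtrancl.cases) (auto simp: S_def adj_in_def)
    qed
    have C_step: "v' \<in> C" if "v \<in> C" "v' \<in> S" "{v, v'} \<in> edges G" for v v'
      using that CS unfolding C_def adj_in_def by (auto intro: rtrancl.rtrancl_into_rtrancl)
    have C_conn: "connected_in G C"
    proof (rule connected_inI[OF uC])
      fix y assume "y \<in> C"
      then have "(u, y) \<in> (adj_in G S)\<^sup>*" by (simp add: C_def)
      then show "(u, y) \<in> (adj_in G C)\<^sup>*"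
      proof (induction rule: rtrancl_induct)
        case (step y y')
        then have "(y, y') \<in> adj_in G C"
          by (auto simp: adj_in_def C_def intro: rtrancl.rtrancl_into_rtrancl)
        then show ?case using step.IH by (rule rtrancl.rtrancl_into_rtrancl[rotated])
      qed simp
    qed
    have z_iso: "{z, v} \<notin> edges G" if "v \<in> C" for v
    proof
      assume "{z, v} \<in> edges G"
      then have "is_minor (complete_ugraph 4) G"
        using that uC CS w(1) xz(3) zV ne wx wu xz(2) C_conn
        by (intro K4_minorI[of "{w}" "{x}" "{z}" C]) (auto simp: S_def connected_singleton)
      then show False using K4 by blast
    qed
    have wx_nbr: "v \<in> {w, x, z, u}" if "w \<in> nbrs G v \<or> x \<in> nbrs G v" for v
      using that wN xz(5) nbrs_sym[of _ G v] by auto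
    have nC: "nbrs G v \<subseteq> C \<union> {w, x}" if "v \<in> C" for v
    proof
      fix y assume y: "y \<in> nbrs G v"
      then have "y \<in> verts G" "y \<noteq> z"
        using nbrs_subset[OF G, of v] z_iso[OF that] by (auto simp: mem_nbrs insert_commute)
      then show "y \<in> C \<union> {w, x}"
        using C_step[OF that, of y] y by (auto simp: S_def mem_nbrs)
    qed
    define D where "D = verts G - C - {w, x}"
    have nD: "nbrs G v \<subseteq> D \<union> {w, x}" if v: "v \<in> D" for v
    proof
      fix y assume y: "y \<in> nbrs G v"
      then have "v \<in> nbrs G y" by (simp add: nbrs_sym[of v])
      then have "y \<notin> C" using nC v by (auto simp: D_def)
      then show "y \<in> D \<union> {w, x}" using nbrs_subset[OF G, of v] y by (auto simp: D_def)
    qed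
    have side: False if T: "T \<subseteq> verts G - {w, x}" "a \<in> T" "a \<in> {z, u}" "b \<in> {z, u}" "b \<notin> T" "r \<notin> T" "s \<notin> T"
      "\<And>v. v \<in> T \<Longrightarrow> nbrs G v \<subseteq> T \<union> {w, x}" for T a b
    proof (rule no_K4_side[of G T a w x])
      show "T \<noteq> verts G" "T \<subseteq> verts G" using T(1) w(1) by auto
      show "3 \<le> card (nbrs G v)" if "v \<in> T" for v
        using that T by (intro deg) auto
      show "nbrs G a \<subseteq> T \<union> {w, x}" "a \<in> T" by (use T in blast)+
      show "nbrs G v \<subseteq> T" if v: "v \<in> T" "v \<noteq> a" for v
      proof -
        have "v \<notin> {w, x, z, u}" using v T by auto
        then have "w \<notin> nbrs G v" "x \<notin> nbrs G v" using wx_nbr by blast+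
        then show ?thesis using T(8)[OF v(1)] by blast
      qed
    qed (use less.hyps G K4 in blast)+
    \<comment> \<open>\<open>r\<close> and \<open>s\<close> are adjacent and different from
      \<open>w\<close> and \<open>x\<close>, so they cannot lie on opposite sides of the
      separation.\<close>
    have "r \<notin> C \<and> s \<notin> C \<or> r \<notin> D \<and> s \<notin> D"
    proof -
      have "s \<in> nbrs G r" "r \<in> nbrs G s" using rs by (auto simp: mem_nbrs insert_commute)
      then show ?thesis
        using nC[of r] nC[of s] nD[of r] nD[of s] w(2) xz(4) by (auto simp: D_def)
    qed
    then show False
    proof
      assume "r \<notin> C \<and> s \<notin> C"
      then show False using nC CS uC by (intro side[of C u z]) (auto simp: S_def)
    next
      assume "r \<notin> D \<and> s \<notin> D"
      then show False using nD uC zV CS ne xz(2) by (intro side[of D z u]) (auto simp: D_def S_def)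
    qed
  qed
qed

section \<open>Connecting the fibers\<close>

text \<open>The simplices of the graph, with the empty one. Thus a neighborhood of at most one
  vertex is a face, and the counts at \<open>p\<close> and \<open>q\<close> are fixed even when pq
  is not an edge. For vertices on an edge these marginals follow from the edge marginals; isolated
  vertices are treated when paths are turned into \<open>moves\<close>.\<close>

definition faces :: "'a ugraph \<Rightarrow> 'a set set" where
  "faces G = insert {} ((\<lambda>v. {v}) ` verts G) \<union> edges G"

lemma faces_subset: "finite_simple_graph G \<Longrightarrow> faces G \<subseteq> Pow (verts G)"
  unfolding faces_def finite_simple_graph_def by auto

lemma faces_add_edge: "faces (add_edge G p q) = insert {p, q} (faces G)"
  by (auto simp: faces_def add_edge_def)

lemma faces_del_vertex:
  assumes "finite_simple_graph G" "x \<in> verts G"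
  shows "faces G = faces (del_vertex G x) \<union> insert {x} ((\<lambda>s. {x, s}) ` nbrs G x)"
proof -
  have "e \<in> (\<lambda>s. {x, s}) ` nbrs G x" if e: "e \<in> edges G" "x \<in> e" for e
  proof -
    obtain u v where "e = {u, v}" using edgeE[OF assms(1) e(1)] by metis
    then have "e = {x, u} \<or> e = {x, v}" using e(2) by auto
    then show ?thesis using e(1) by (auto simp: nbrs_def)
  qed
  moreover have "{x, s} \<in> edges G" if "s \<in> nbrs G x" for s using that by (simp add: mem_nbrs)
  ultimately show ?thesis
    using assms(2) by (auto simp: faces_def del_vertex_def)
qed

lemma card_le_2_cases:
  assumes "finite S" "card S \<le> 2"
  obtains "S = {}" | p where "S = {p}" | p q where "S = {p, q}" "p \<noteq> q"
proof -
  have "card S = 0 \<or> card S = 1 \<or> card S = 2" using assms(2) by auto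
  then show ?thesis
    using that assms(1) by (metis card_0_eq card_1_singletonE card_2_iff)
qed

lemma small_nbrs_face:
  assumes "finite_simple_graph G" "card (nbrs G x) \<le> 1"
  shows "nbrs G x \<in> faces (del_vertex G x)"
proof -
  have "card (nbrs G x) = 0 \<or> card (nbrs G x) = 1" using assms(2) by auto
  then show ?thesis
    using finite_nbrs[OF assms(1)] nbrs_subset[OF assms(1), of x]
    by (auto simp: faces_def del_vertex_def card_1_singleton_iff)
qed

lemma linked_refl: "finer V E F \<Longrightarrow> linked k V E F"
  unfolding linked_def steps_def using same_finer by fast

lemma linked_path_faces:
  assumes G: "finite_simple_graph G" and x: "x \<in> verts G" and N: "nbrs G x = {p, q}" "p \<noteq> q"
    and l: "linked 2 (verts G - {x}) (faces (del_vertex G x)) (insert {p, q} (faces (del_vertex G x)))"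
  shows "linked 2 (verts G) (faces G) (insert {p, q} (faces G))"
proof -
  let ?H = "del_vertex G x" and ?V = "verts G - {x}"
  have V: "insert x ?V = verts G" using x by blast
  have pq: "p \<in> ?V" "q \<in> ?V" using nbrs_subset[OF G, of x] N by auto
  have sub: "faces ?H \<subseteq> Pow ?V"
    using faces_subset[OF simple_del_vertex[OF G], of x] by (simp add: del_vertex_def)
  have "{p} \<in> faces ?H" "{q} \<in> faces ?H" using pq by (auto simp: faces_def del_vertex_def)
  with linked_path[OF l _ pq N(2) _ _ sub, of x]
  have l2: "linked 2 (verts G) (faces ?H \<union> {{x, p}, {x, q}}) (insert {p, q} (faces ?H \<union> {{x, p}, {x, q}}))"
    unfolding V by simp
  have F: "faces G = insert {x} (faces ?H \<union> {{x, p}, {x, q}})"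
    using faces_del_vertex[OF G x] N by auto
  show ?thesis
    by (rule linked_mono[OF l2 order_refl]) (unfold F, auto simp: finer_def)
qed

lemma linked_lift_faces:
  assumes G: "finite_simple_graph G" and x: "x \<in> verts G" and N: "nbrs G x \<in> faces (del_vertex G x)"
    and F: "F \<subseteq> Pow (verts G - {x})"
    and l: "linked k (verts G - {x}) (faces (del_vertex G x)) (faces (del_vertex G x) \<union> F)"
  shows "linked k (verts G) (faces G) (faces G \<union> F)"
proof -
  let ?H = "del_vertex G x" and ?V = "verts G - {x}" and ?X = "insert {x} ((\<lambda>s. {x, s}) ` nbrs G x)"
  have V: "insert x ?V = verts G" using x by blast
  have sub: "faces ?H \<subseteq> Pow ?V"
    using faces_subset[OF simple_del_vertex[OF G], of x] by (simp add: del_vertex_def)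
  have "linked k (insert x ?V) (faces ?H \<union> ?X) ((faces ?H \<union> F) \<union> ?X)"
    by (rule linked_lift[OF l, where S = "nbrs G x"]) (use N sub F nbrs_subset[OF G, of x] in auto)
  moreover have "(faces ?H \<union> F) \<union> ?X = faces G \<union> F"
    using faces_del_vertex[OF G x] by blast
  ultimately show ?thesis
    unfolding V faces_del_vertex[OF G x, symmetric] by simp
qed

text \<open>Three refinements: lifted moves of the smaller graph fix the marginal on
  \<open>verts G - {x}\<close>, flips of \<open>x\<close> fix the marginal on \<open>x\<close> with
  its neighbors, and exchanges of labels of \<open>x\<close> fix the table. Only the flips, for two
  neighbors, take four rows; with at most one neighbor, the set in question is already a
  face.\<close>

lemma linked_conn_faces:
  assumes G: "finite_simple_graph G" and x: "x \<in> verts G" and N: "nbrs G x \<in> faces (del_vertex G x)"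
    and k: "card (nbrs G x) \<le> 1 \<and> 2 \<le> k \<or> card (nbrs G x) \<le> 2 \<and> 4 \<le> k"
    and l: "linked k (verts G - {x}) (faces (del_vertex G x)) {verts G - {x}}"
  shows "linked k (verts G) (faces G) {verts G}"
proof -
  let ?H = "del_vertex G x" and ?V = "verts G - {x}" and ?S = "nbrs G x"
  let ?F = "insert ?V (faces G)"
  have V: "insert x ?V = verts G" using x by blast
  have subS: "?S \<subseteq> ?V" using nbrs_subset[OF G] .
  have sub: "faces ?H \<subseteq> Pow ?V"
    using faces_subset[OF simple_del_vertex[OF G], of x] by (simp add: del_vertex_def)
  have "linked k ?V (faces ?H) (faces ?H \<union> {?V})"
    by (rule linked_mono[OF l]) (use sub in \<open>auto simp: finer_def\<close>)
  then have 1: "linked k (verts G) (faces G) ?F"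
    using linked_lift_faces[OF G x N, of "{?V}"] by simp
  have F: "?F = insert {x} ((faces ?H \<union> {?V}) \<union> ((\<lambda>s. {x, s}) ` ?S))"
    using faces_del_vertex[OF G x] by auto
  have 2: "linked k (verts G) ?F (insert (insert x ?S) ?F)"
  proof -
    consider "?S = {}" | s where "?S = {s}" | p q where "?S = {p, q}" "p \<noteq> q"
      using card_le_2_cases[OF finite_nbrs[OF G]] k by (metis le_trans one_le_numeral)
    then show ?thesis
    proof cases
      case 1
      then show ?thesis
        by (intro linked_refl finer_superset) (auto simp: F)
    next
      case (2 s)
      then show ?thesis
        by (intro linked_refl finer_superset) (auto simp: F)
    next
      case (3 p q)
      then have k4: "4 \<le> k" using k by simp
      have "linked 4 (insert x ?V) ((faces ?H \<union> {?V}) \<union> {{x, p}, {x, q}}) ((faces ?H \<union> {?V}) \<union> {{x, p, q}})"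
        by (rule linked_triangle) (use 3 N sub subS in auto)
      then show ?thesis
        unfolding V F by (rule linked_mono[OF _ k4]) (use 3 in \<open>auto simp: finer_def\<close>)
    qed
  qed
  have "linked 2 (verts G) {?V, insert x ?S} {verts G}"
    using linked_cond_indep[of x ?V ?S] subS V by simp
  then have 3: "linked k (verts G) (insert (insert x ?S) ?F) {verts G}"
  proof (rule linked_mono)
    show "finer (verts G) {?V, insert x ?S} (insert (insert x ?S) ?F)"
      unfolding F finer_def using sub by auto
    show "finer (verts G) (insert (insert x ?S) ?F) {?V, insert x ?S}"
      by (intro finer_superset) auto
    show "2 \<le> k" using k by auto
  qed (auto simp: finer_def)
  have "linked k (verts G) ?F {verts G}"
    by (rule linked_trans[OF 2 3]) (intro finer_superset, auto)
  then show ?thesis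
    by (rule linked_trans[OF 1]) (intro finer_superset, auto)
qed

lemma simple_graph_low_degree:
  assumes G: "finite_simple_graph G" and "verts G \<noteq> {}" "\<not> is_minor (complete_ugraph 4) G"
  shows "\<exists>x\<in>verts G. card (nbrs G x) \<le> 2"
proof (cases "3 \<le> card (verts G) \<and> edges G \<noteq> {}")
  case True
  then obtain e where "e \<in> edges G" by blast
  then obtain r s where "{r, s} \<in> edges G" using edgeE[OF G] by metis
  then show ?thesis
    using low_degree_vertex_of_K4_minor_free[OF G] True assms(3) by blast
next
  case False
  obtain x where x: "x \<in> verts G" using assms(2) by blast
  have "card (nbrs G x) \<le> 2"
  proof (cases "edges G = {}")
    case True
    then show ?thesis by (simp add: nbrs_def)
  next
    case F: False
    have "card (nbrs G x) \<le> card (verts G)"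
      using nbrs_subset[OF G, of x] G by (intro card_mono) (auto simp: finite_simple_graph_def)
    then show ?thesis using False F by linarith
  qed
  then show ?thesis using x by blast
qed

section \<open>The recursion that deletes a vertex of degree at most two\<close>

lemma contract_edges:
  assumes "v \<in> nbrs G x" "v \<noteq> z"
  shows "edges (add_edge (del_vertex G x) z v) \<subseteq> edges (contract G x z)"
    "verts (add_edge (del_vertex G x) z v) \<subseteq> verts (contract G x z)"
  using assms by (auto simp: contract_def add_edge_def del_vertex_def)

text \<open>Contracting one edge at \<open>x\<close> turns the other edge at \<open>x\<close> into
  the edge between \<open>z\<close> and \<open>v\<close>.\<close>

lemma is_minor_add_del:
  assumes m: "is_minor H (add_edge (del_vertex G x) z v)" and G: "finite_simple_graph G"
    and e: "{x, z} \<in> edges G" "{x, v} \<in> edges G" "v \<noteq> z"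
  shows "is_minor H G"
proof -
  have "v \<in> nbrs G x" using e(2) by (simp add: mem_nbrs)
  from is_minor_mono[OF m contract_edges(2)[OF this e(3)] contract_edges(1)[OF this e(3)]]
  show ?thesis using is_minor_contract G e(1) by metis
qed

text \<open>The pair varies in the induction. When the neighbors p, q of the deleted vertex x are
  not adjacent, the hypothesis is used twice: for G - x with the pair p, q, which via
  \<open>linked_path_faces\<close> fixes the {p, q}-marginal in G, and for G - x + pq with the pair
  y, z, whose moves lift because the neighborhood of x has become a face.\<close>

lemma linked_add_edge:
  assumes "finite_simple_graph G" "y \<in> verts G" "z \<in> verts G" "y \<noteq> z"
    "\<not> is_minor (complete_ugraph 4) (add_edge G y z)"
  shows "linked 2 (verts G) (faces G) (insert {y, z} (faces G))"
  using assms
proof (induction "card (verts G)" arbitrary: G y z rule: less_induct)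
  case less
  note G = less.prems(1) and yz = less.prems(2,3,4) and K4 = less.prems(5)
  let ?G' = "add_edge G y z"
  have G': "finite_simple_graph ?G'" using simple_add_edge G yz by metis
  have finV: "finite (verts G)" using G by (simp add: finite_simple_graph_def)
  show ?case
  proof (cases "card (verts G) = 2")
    case True
    then have V: "verts G = {y, z}"
      using yz finV by (metis card_2_iff card_subset_eq empty_subsetI insert_subset)
    \<comment> \<open>Two vertices without an edge: conditional independence with empty
      \<open>S\<close>.\<close>
    have "linked 2 (insert z {y}) {{y}, insert z {}} {insert z {y}}"
      by (rule linked_cond_indep) (use yz in auto)
    then have l: "linked 2 (verts G) {{y}, {z}} {{y, z}}" by (simp add: V insert_commute)
    show ?thesis
    proof (cases "{y, z} \<in> edges G")
      case True
      then have "insert {y, z} (faces G) = faces G" by (auto simp: faces_def)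
      then show ?thesis by (simp add: linked_refl finer_superset)
    next
      case False
      have "edges G = {}"
      proof (rule ccontr)
        assume "edges G \<noteq> {}"
        then obtain e where "e \<in> edges G" by blast
        then have "e \<in> edges G" "e \<subseteq> {y, z}" "card e = 2"
          using G V unfolding finite_simple_graph_def by auto
        then show False using False yz
          by (metis V True card_subset_eq finV)
      qed
      then have "faces G = {{}, {y}, {z}}" by (auto simp: faces_def V)
      then show ?thesis by (intro linked_mono[OF l]) (auto simp: finer_def V)
    qed
  next
    case False
    have "card {y, z} \<le> card (verts G)" using yz finV by (intro card_mono) auto
    then have c3: "3 \<le> card (verts G)" using False yz by simp
    have "{y, z} \<in> edges ?G'" "3 \<le> card (verts ?G')" using c3 by (auto simp: add_edge_def)
    from low_degree_vertex_of_K4_minor_free[OF G' this K4]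
    obtain x where x: "x \<in> verts G" "x \<noteq> y" "x \<noteq> z" "card (nbrs ?G' x) \<le> 2"
      by (auto simp: add_edge_def)
    have "nbrs ?G' x = nbrs G x" using x(2,3) by (auto simp: nbrs_def add_edge_def doubleton_eq_iff)
    then have deg: "card (nbrs G x) \<le> 2" using x(4) by simp
    let ?H = "del_vertex G x" and ?V = "verts G - {x}"
    have H: "finite_simple_graph ?H" using simple_del_vertex[OF G] .
    have VH: "verts ?H = ?V" by (simp add: del_vertex_def)
    have cV: "card ?V < card (verts G)" using x(1) finV by (rule card_Diff1_less[rotated])
    have yzV: "y \<in> ?V" "z \<in> ?V" using yz x by auto
    have lift: ?thesis if N: "nbrs G x \<in> faces ?H"
    proof -
      have "\<not> is_minor (complete_ugraph 4) (add_edge ?H y z)"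
        using K4 is_minor_mono[of "complete_ugraph 4" "add_edge ?H y z" ?G']
        by (auto simp: add_edge_def del_vertex_def)
      then have "linked 2 ?V (faces ?H) (faces ?H \<union> {{y, z}})"
        using less.hyps[of ?H y z] cV H yz yzV VH by simp
      then show ?thesis using linked_lift_faces[OF G x(1) N, of "{{y, z}}"] yzV by simp
    qed
    show ?thesis
    proof (cases "nbrs G x \<in> faces ?H")
      case True
      then show ?thesis by (rule lift)
    next
      case F: False
      then have "card (nbrs G x) = 2" using small_nbrs_face[OF G, of x] deg by linarith
      then obtain p q where N: "nbrs G x = {p, q}" "p \<noteq> q" by (meson card_2_iff)
      have e: "{x, p} \<in> edges G" "{x, q} \<in> edges G" using N by (auto simp: mem_nbrs[symmetric])
      have pqV: "p \<in> ?V" "q \<in> ?V" using nbrs_subset[OF G, of x] N by auto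
      have sub: "verts G \<subseteq> verts ?G'" "edges G \<subseteq> edges ?G'" by (auto simp: add_edge_def)
      have e': "{x, p} \<in> edges ?G'" "{x, q} \<in> edges ?G'" using e by (auto simp: add_edge_def)
      have "\<not> is_minor (complete_ugraph 4) (add_edge ?H p q)"
        using is_minor_add_del[OF _ G e N(2)[symmetric], of "complete_ugraph 4"] is_minor_mono[OF _ sub] K4 by blast
      then have "linked 2 ?V (faces ?H) (insert {p, q} (faces ?H))"
        using less.hyps[of ?H p q] cV H N(2) pqV VH by simp
      then have 1: "linked 2 (verts G) (faces G) (insert {p, q} (faces G))"
        using linked_path_faces[OF G x(1) N] by blast
      let ?G2 = "add_edge G p q" and ?H2 = "add_edge ?H p q"
      have G2: "finite_simple_graph ?G2" using simple_add_edge[OF G] pqV N(2) by blast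
      have H2: "finite_simple_graph ?H2" using simple_add_edge[OF H] pqV N(2) VH by blast
      have xpq: "x \<noteq> p" "x \<noteq> q" using pqV by auto
      have dG2: "del_vertex ?G2 x = ?H2" using xpq by (auto simp: add_edge_def del_vertex_def)
      \<comment> \<open>\<open>p\<close> and \<open>q\<close> are neighbors of \<open>x\<close> also
        in G + yz, so G - x + pq + yz is a minor of G + yz.\<close>
      have "\<not> is_minor (complete_ugraph 4) (add_edge (del_vertex ?G' x) p q)"
        using is_minor_add_del[OF _ G' e' N(2)[symmetric], of "complete_ugraph 4"] K4 by blast
      moreover have "add_edge (del_vertex ?G' x) p q = add_edge ?H2 y z"
        using x(2,3) by (auto simp: add_edge_def del_vertex_def)
      ultimately have "linked 2 ?V (faces ?H2) (insert {y, z} (faces ?H2))"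
        using less.hyps[of ?H2 y z] cV H2 yz yzV VH by (simp add: add_edge_def)
      then have l: "linked 2 (verts ?G2 - {x}) (faces (del_vertex ?G2 x)) (faces (del_vertex ?G2 x) \<union> {{y, z}})"
        unfolding dG2 by (simp add: add_edge_def)
      have V2: "verts ?G2 = verts G" by (simp add: add_edge_def)
      have "nbrs ?G2 x = {p, q}" using N xpq by (auto simp: nbrs_def add_edge_def doubleton_eq_iff)
      then have "nbrs ?G2 x \<in> faces (del_vertex ?G2 x)" unfolding dG2 by (simp add: faces_add_edge)
      from linked_lift_faces[OF G2 _ this _ l] x(1) yzV
      have "linked 2 (verts G) (insert {p, q} (faces G)) (insert {p, q} (faces G) \<union> {{y, z}})"
        unfolding V2 faces_add_edge by simp
      from linked_trans[OF 1 this] have "linked 2 (verts G) (faces G) (insert {p, q} (faces G) \<union> {{y, z}})"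
        by (simp add: finer_superset subset_insertI)
      then show ?thesis
        by (rule linked_mono) (auto intro: finer_superset)
    qed
  qed
qed

text \<open>For non-adjacent neighbors p, q of x, two-row moves first fix the {p, q}-marginal;
  afterwards G + pq is treated, where the neighbors of x form an edge. Both uses of a hypothesis on
  minors concern the smaller graph G - x + pq, a minor of G.\<close>

lemma linked_K4_minor_free:
  assumes "finite_simple_graph G" "\<not> is_minor (complete_ugraph 4) G"
  shows "linked 4 (verts G) (faces G) {verts G}"
  using assms
proof (induction "card (verts G)" arbitrary: G rule: less_induct)
  case less
  note G = less.prems(1) and K4 = less.prems(2)
  have finV: "finite (verts G)" using G by (simp add: finite_simple_graph_def)
  show ?case
  proof (cases "verts G = {}")
    case True
    then show ?thesis by (intro linked_refl) (auto simp: finer_def faces_def)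
  next
    case False
    then obtain x where x: "x \<in> verts G" "card (nbrs G x) \<le> 2"
      using simple_graph_low_degree[OF G _ K4] by blast
    let ?H = "del_vertex G x" and ?V = "verts G - {x}"
    have H: "finite_simple_graph ?H" using simple_del_vertex[OF G] .
    have VH: "verts ?H = ?V" by (simp add: del_vertex_def)
    have cV: "card ?V < card (verts G)" using x(1) finV by (rule card_Diff1_less[rotated])
    show ?thesis
    proof (cases "nbrs G x \<in> faces ?H")
      case True
      have "\<not> is_minor (complete_ugraph 4) ?H"
        using K4 is_minor_mono[of "complete_ugraph 4" ?H G] by (auto simp: del_vertex_def)
      then have "linked 4 ?V (faces ?H) {?V}" using less.hyps[of ?H] cV H VH by simp
      then show ?thesis using linked_conn_faces[OF G x(1) True] x(2) by simp
    next
      case F: False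
      then have "card (nbrs G x) = 2" using small_nbrs_face[OF G, of x] x(2) by linarith
      then obtain p q where N: "nbrs G x = {p, q}" "p \<noteq> q" by (meson card_2_iff)
      have e: "{x, p} \<in> edges G" "{x, q} \<in> edges G" using N by (auto simp: mem_nbrs[symmetric])
      have pqV: "p \<in> ?V" "q \<in> ?V" using nbrs_subset[OF G, of x] N by auto
      let ?G2 = "add_edge G p q" and ?H2 = "add_edge ?H p q"
      have K4H: "\<not> is_minor (complete_ugraph 4) ?H2"
        using is_minor_add_del[OF _ G e N(2)[symmetric], of "complete_ugraph 4"] K4 by blast
      then have "linked 2 ?V (faces ?H) (insert {p, q} (faces ?H))"
        using linked_add_edge[of ?H p q] H pqV N(2) VH by simp
      then have "linked 2 (verts G) (faces G) (insert {p, q} (faces G))"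
        using linked_path_faces[OF G x(1) N] by blast
      then have 1: "linked 4 (verts G) (faces G) (insert {p, q} (faces G))"
        by (rule linked_mono) (simp_all add: finer_superset)
      have G2: "finite_simple_graph ?G2" using simple_add_edge[OF G] pqV N(2) by blast
      have H2: "finite_simple_graph ?H2" using simple_add_edge[OF H] pqV N(2) VH by blast
      have xpq: "x \<noteq> p" "x \<noteq> q" using pqV by auto
      have dG2: "del_vertex ?G2 x = ?H2" using xpq by (auto simp: add_edge_def del_vertex_def)
      have V2: "verts ?G2 = verts G" by (simp add: add_edge_def)
      have VH2: "verts ?H2 = ?V" by (simp add: add_edge_def del_vertex_def)
      have "linked 4 ?V (faces ?H2) {?V}"
        using less.hyps[of ?H2] cV H2 VH2 K4H by simp
      moreover have N2: "nbrs ?G2 x = {p, q}" using N xpq by (auto simp: nbrs_def add_edge_def doubleton_eq_iff)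
      then have "nbrs ?G2 x \<in> faces (del_vertex ?G2 x)" unfolding dG2 by (simp add: faces_add_edge)
      moreover have "card (nbrs ?G2 x) \<le> 2" unfolding N2 by (simp add: card_insert_if)
      ultimately have "linked 4 (verts G) (insert {p, q} (faces G)) {verts G}"
        using linked_conn_faces[OF G2, of x 4] x(1) V2 dG2 by (simp add: faces_add_edge)
      from linked_trans[OF 1 this] show ?thesis by (simp add: finer_superset subset_insertI)
    qed
  qed
qed

section \<open>Forests\<close>

lemma cycle_of_min_degree_2:
  assumes G: "finite_simple_graph G" and "verts G \<noteq> {}"
    and deg: "\<And>x. x \<in> verts G \<Longrightarrow> 2 \<le> card (nbrs G x)"
  shows "\<exists>xs. is_cycle G xs"
proof -
  have finV: "finite (verts G)" using G by (simp add: finite_simple_graph_def)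
  define P where "P xs \<longleftrightarrow> xs \<noteq> [] \<and> distinct xs \<and> set xs \<subseteq> verts G \<and>
    (\<forall>i. Suc i < length xs \<longrightarrow> {xs ! i, xs ! Suc i} \<in> edges G)" for xs
  obtain v where "v \<in> verts G" using assms(2) by blast
  then have "P [v]" by (simp add: P_def)
  moreover have "length xs \<le> card (verts G)" if "P xs" for xs
    using that finV by (metis P_def card_mono distinct_card)
  \<comment> \<open>In a longest path all neighbors of its first vertex lie on the path; one that is
    not the second vertex closes a cycle.\<close>
  ultimately obtain xs where xs: "P xs" and max: "\<And>ys. P ys \<Longrightarrow> length ys \<le> length xs"
    using ex_has_greatest_nat[of P "[v]" length "Suc (card (verts G))"] by (metis le_imp_less_Suc less_imp_le)
  obtain x ys where xys: "xs = x # ys" using xs by (cases xs) (auto simp: P_def)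
  have x: "x \<in> verts G" using xs by (simp add: P_def xys)
  have nb: "u \<in> set ys" if u: "u \<in> nbrs G x" for u
  proof (rule ccontr)
    assume "u \<notin> set ys"
    moreover have "u \<noteq> x" "u \<in> verts G" using nbrs_subset[OF G, of x] u by auto
    moreover have "{u, x} \<in> edges G" using u by (simp add: mem_nbrs insert_commute)
    ultimately have "P (u # xs)"
      using xs unfolding P_def xys by (auto simp: nth_Cons split: nat.splits)
    then show False using max[of "u # xs"] by simp
  qed
  have "\<not> nbrs G x \<subseteq> {xs ! 1}"
  proof
    assume "nbrs G x \<subseteq> {xs ! 1}"
    then have "card (nbrs G x) \<le> card {xs ! 1}" by (intro card_mono) auto
    then show False using deg[OF x] by simp
  qed
  then obtain u where u: "u \<in> nbrs G x" "u \<noteq> xs ! 1" by blast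
  then obtain i where i: "i < length ys" "ys ! i = u" using nb by (metis in_set_conv_nth)
  then have i1: "xs ! Suc i = u" "1 \<le> i" using u(2) by (auto simp: xys Suc_le_eq intro: gr0I)
  \<comment> \<open>The index \<open>i\<close> counts in the tail \<open>ys\<close>, so
    \<open>u\<close> is entry \<open>Suc i\<close> of \<open>xs\<close> and the last entry of
    \<open>cs\<close>. As \<open>u\<close> is not the second vertex, \<open>i\<close> is positive
    and the cycle has at least three vertices.\<close>
  define cs where "cs = take (Suc (Suc i)) xs"
  have len: "length cs = Suc (Suc i)" using i by (simp add: cs_def xys)
  have "{cs ! j, cs ! (Suc j mod length cs)} \<in> edges G" if "j < length cs" for j
  proof (cases "j = Suc i")
    case True
    then have "cs ! j = u" "cs ! (Suc j mod length cs) = x" using i1 len by (simp_all add: cs_def xys)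
    then show ?thesis using u(1) by (simp add: mem_nbrs insert_commute)
  next
    case False
    then have j: "j < Suc i" using that len by simp
    then have "cs ! j = xs ! j" "cs ! (Suc j mod length cs) = xs ! Suc j" using len by (simp_all add: cs_def)
    moreover have "Suc j < length xs" using j i by (simp add: xys)
    ultimately show ?thesis using xs by (simp add: P_def)
  qed
  moreover have "distinct cs" "set cs \<subseteq> verts G"
    using xs set_take_subset[of "Suc (Suc i)" xs] by (auto simp: P_def cs_def)
  ultimately have "is_cycle G cs"
    using len i1 by (simp add: is_cycle_def)
  then show ?thesis ..
qed

lemma linked_forest:
  assumes "finite_simple_graph G" "is_forest G"
  shows "linked 2 (verts G) (faces G) {verts G}"
  using assms
proof (induction "card (verts G)" arbitrary: G rule: less_induct)
  case less
  note G = less.prems(1)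
  have finV: "finite (verts G)" using G by (simp add: finite_simple_graph_def)
  show ?case
  proof (cases "verts G = {}")
    case True
    then show ?thesis by (intro linked_refl) (auto simp: finer_def faces_def)
  next
    case False
    then obtain x where x: "x \<in> verts G" "card (nbrs G x) \<le> 1"
      using cycle_of_min_degree_2[OF G] less.prems(2) unfolding is_forest_def
      by (metis not_less_eq_eq numeral_2_eq_2 One_nat_def)
    let ?H = "del_vertex G x" and ?V = "verts G - {x}"
    have "is_forest ?H"
      using less.prems(2) by (auto simp: is_forest_def is_cycle_def del_vertex_def)
    moreover have "card ?V < card (verts G)" using x(1) finV by (rule card_Diff1_less[rotated])
    ultimately have "linked 2 ?V (faces ?H) {?V}"
      using less.hyps[of ?H] simple_del_vertex[OF G] by (simp add: del_vertex_def)
    then show ?thesis using linked_conn_faces[OF G x(1) small_nbrs_face[OF G x(2)]] x(2) by simp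
  qed
qed

section \<open>Lower bounds from complete minors\<close>

definition moves :: "nat \<Rightarrow> 'a ugraph \<Rightarrow> 'a set multiset rel" where
  "moves k G = {(M, N). M \<in> tables (verts G) \<and> N \<in> tables (verts G) \<and> same (edges G) M N \<and> move k M N}"

lemma moves_rtrancl_same: "(M, N) \<in> (moves k G)\<^sup>* \<Longrightarrow> same (edges G) M N"
  by (induction rule: rtrancl_induct) (auto simp: moves_def intro: same_trans)

lemma K3_minorI:
  assumes con: "connected_in G A" "connected_in G B" "connected_in G C"
    and sub: "A \<subseteq> verts G" "B \<subseteq> verts G" "C \<subseteq> verts G"
    and dis: "A \<inter> B = {}" "A \<inter> C = {}" "B \<inter> C = {}"
    and e: "\<exists>u\<in>A. \<exists>v\<in>B. {u, v} \<in> edges G" "\<exists>u\<in>A. \<exists>v\<in>C. {u, v} \<in> edges G"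
      "\<exists>u\<in>B. \<exists>v\<in>C. {u, v} \<in> edges G"
  shows "is_minor (complete_ugraph 3) G"
proof -
  define Br where "Br i = (if i = 0 then A else if i = 1 then B else C)" for i :: nat
  have "\<exists>u\<in>Br i. \<exists>v\<in>Br j. {u, v} \<in> edges G" if "{i, j} \<in> edges (complete_ugraph 3)" for i j
  proof -
    have "i < 3" "j < 3" "i \<noteq> j" using that by (auto simp: complete_ugraph_def)
    then have ij: "i \<in> {0, 1, 2}" "j \<in> {0, 1, 2}" "i \<noteq> j" by auto
    have s: "\<exists>u\<in>S. \<exists>v\<in>T. {u, v} \<in> edges G" if "\<exists>u\<in>T. \<exists>v\<in>S. {u, v} \<in> edges G" for S T
      using that by (metis insert_commute)
    show ?thesis
      using ij e e[THEN s] by (auto simp: Br_def)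
  qed
  moreover have "disjoint_family_on Br (verts (complete_ugraph 3))"
    using dis unfolding disjoint_family_on_def complete_ugraph_def by (auto simp: Br_def)
  moreover have "\<forall>i\<in>verts (complete_ugraph 3). Br i \<subseteq> verts G \<and> connected_in G (Br i)"
    using con sub by (auto simp: Br_def)
  ultimately show ?thesis unfolding is_minor_def by (intro exI[of _ Br]) auto
qed

text \<open>The first two vertices of the cycle are branch sets by themselves, and all later ones
  together form the third.\<close>

lemma triangle_minor_of_cycle:
  assumes "is_cycle G xs"
  shows "is_minor (complete_ugraph 3) G"
proof -
  have xs: "3 \<le> length xs" "distinct xs" "set xs \<subseteq> verts G"
    and e: "\<And>i. i < length xs \<Longrightarrow> {xs ! i, xs ! (Suc i mod length xs)} \<in> edges G"
    using assms by (auto simp: is_cycle_def)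
  have e': "{xs ! i, xs ! Suc i} \<in> edges G" if "Suc i < length xs" for i
    using e[of i] that by simp
  define P where "P = (\<lambda>j. xs ! j) ` {2..<length xs}"
  have P: "xs ! j \<in> P" if "2 \<le> j" "j < length xs" for j
    using that by (simp add: P_def)
  have nP: "xs ! i \<notin> P" if "i < 2" for i
    using that xs(1,2) by (auto simp: P_def nth_eq_iff_index_eq)
  show ?thesis
  proof (rule K3_minorI[of G "{xs ! 0}" "{xs ! 1}" P])
    show "connected_in G P"
    proof (rule connected_inI)
      show "xs ! 2 \<in> P" using P xs(1) by simp
      have "(xs ! 2, xs ! j) \<in> (adj_in G P)\<^sup>*" if "2 \<le> j" "j < length xs" for j
        using that
      proof (induction j rule: dec_induct)
        case (step i)
        then have "(xs ! i, xs ! Suc i) \<in> adj_in G P"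
          using P e' by (simp add: adj_in_def)
        then show ?case using step by (simp add: rtrancl.rtrancl_into_rtrancl)
      qed simp
      then show "(xs ! 2, y) \<in> (adj_in G P)\<^sup>*" if "y \<in> P" for y using that by (auto simp: P_def)
    qed
    show "P \<subseteq> verts G" using xs(3) nth_mem by (fastforce simp: P_def)
    show "{xs ! 0} \<subseteq> verts G" "{xs ! 1} \<subseteq> verts G" using xs(1) by (auto intro!: subsetD[OF xs(3)] nth_mem)
    have "xs ! 0 \<noteq> xs ! 1"
      by (subst nth_eq_iff_index_eq[OF xs(2)]) (use xs(1) in auto)
    then show "{xs ! 0} \<inter> {xs ! 1} = {}" by simp
    show "{xs ! 0} \<inter> P = {}" "{xs ! 1} \<inter> P = {}" using nP[of 0] nP[of 1] by simp_all
    have "{xs ! 0, xs ! 1} \<in> edges G" "{xs ! 1, xs ! 2} \<in> edges G"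
      using e'[of 0] e'[of 1] xs(1) by (simp_all add: numeral_2_eq_2)
    moreover have l: "Suc (length xs - 1) = length xs" using xs(1) by simp
    have "{xs ! 0, xs ! (length xs - 1)} \<in> edges G"
      using e[of "length xs - 1"] xs(1) unfolding l by (simp add: insert_commute)
    moreover have "xs ! (length xs - 1) \<in> P" "xs ! 2 \<in> P" using xs(1) by (auto intro: P)
    ultimately show "\<exists>u\<in>{xs ! 0}. \<exists>v\<in>{xs ! 1}. {u, v} \<in> edges G" "\<exists>u\<in>{xs ! 0}. \<exists>v\<in>P. {u, v} \<in> edges G"
      "\<exists>u\<in>{xs ! 1}. \<exists>v\<in>P. {u, v} \<in> edges G" by blast+
  qed (simp_all add: connected_singleton)
qed

lemma image_mset_factor:
  assumes "image_mset g M = image_mset g N" "\<And>a. a \<in># M \<Longrightarrow> f a = h (g a)" "\<And>a. a \<in># N \<Longrightarrow> f' a = h (g a)"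
  shows "image_mset f M = image_mset f' N"
proof -
  have "image_mset f M = image_mset h (image_mset g M)"
    using assms(2) by (simp add: multiset.map_comp cong: image_mset_cong)
  also have "\<dots> = image_mset f' N"
    unfolding assms(1) using assms(3) by (simp add: multiset.map_comp cong: image_mset_cong)
  finally show ?thesis .
qed

text \<open>Tables on \<open>K\<^sub>n\<close> correspond to tables on \<open>G\<close> whose rows are constant on branch sets and zero
  elsewhere. Constancy on branch sets is forced by the edge marginals, so a path of moves in \<open>G\<close>
  can be read off on representatives of the branch sets.\<close>

lemma moves_complete_minor:
  assumes m: "is_minor (complete_ugraph n) G" and n: "2 \<le> n" and G: "finite_simple_graph G"
    and all: "\<And>M N. M \<in> tables (verts G) \<Longrightarrow> N \<in> tables (verts G) \<Longrightarrow> same (edges G) M N \<Longrightarrow> (M, N) \<in> (moves k G)\<^sup>*"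
    and T: "T \<in> tables {..<n}" "T' \<in> tables {..<n}" "same (edges (complete_ugraph n)) T T'"
  shows "(T, T') \<in> (moves k (complete_ugraph n))\<^sup>*"
proof -
  let ?K = "complete_ugraph n"
  have VK: "verts ?K = {..<n}" by (simp add: complete_ugraph_def)
  obtain Br where Br: "\<And>i. i < n \<Longrightarrow> Br i \<subseteq> verts G \<and> connected_in G (Br i)"
      "disjoint_family_on Br {..<n}"
      "\<And>i j. {i, j} \<in> edges ?K \<Longrightarrow> \<exists>u\<in>Br i. \<exists>v\<in>Br j. {u, v} \<in> edges G"
    using m unfolding is_minor_def VK by (metis lessThan_iff)
  have uniq: "i = j" if "u \<in> Br i" "u \<in> Br j" "i < n" "j < n" for u i j
    using Br(2) that unfolding disjoint_family_on_def by blast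
  define lift where "lift a = (\<Union>i\<in>a. Br i)" for a
  define r where "r i = (SOME u. u \<in> Br i)" for i
  have r: "r i \<in> Br i" if "i < n" for i
    using Br(1)[OF that] unfolding r_def connected_in_def by (metis someI_ex ex_in_conv)
  define push where "push s = {i. i < n \<and> r i \<in> s}" for s
  have mem_lift: "u \<in> lift a \<longleftrightarrow> i \<in> a" if "u \<in> Br i" "i < n" "a \<subseteq> {..<n}" for u i a
    using that uniq by (auto simp: lift_def)
  have push_lift: "push (lift a) = a" if "a \<subseteq> {..<n}" for a
    using that mem_lift[OF r _ that] by (auto simp: push_def)
  have push_lift_mset: "image_mset push (image_mset lift L) = L" if "L \<in> tables {..<n}" for L
    unfolding multiset.map_comp
    by (rule trans[OF image_mset_cong[where g = "\<lambda>a. a"]]) (use that push_lift in \<open>auto simp: tables_def\<close>)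
  have lift_tables: "image_mset lift L \<in> tables (verts G)" if "L \<in> tables {..<n}" for L
    using that Br(1) by (fastforce simp: tables_def lift_def)
  have push_tables: "image_mset push L \<in> tables {..<n}" for L
    by (auto simp: tables_def push_def)
  have same_lift: "same (edges G) (image_mset lift T) (image_mset lift T')"
    unfolding same_def
  proof
    fix e assume "e \<in> edges G"
    then obtain u v where e: "e = {u, v}" using edgeE[OF G] by metis
    \<comment> \<open>The branch sets met by \<open>e\<close>: at most two, since each end lies in
      at most one. Enlarged to a pair they form an edge of the complete graph, so the marginal on
      \<open>J\<close> is known, and it determines the trace of lifted rows on
      \<open>e\<close>.\<close>
    define J where "J = {i. i < n \<and> u \<in> Br i} \<union> {i. i < n \<and> v \<in> Br i}"
    have c1: "card {i. i < n \<and> w \<in> Br i} \<le> 1" for w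
    proof (cases "\<exists>j. j < n \<and> w \<in> Br j")
      case True
      then obtain j where "j < n" "w \<in> Br j" by blast
      then have "{i. i < n \<and> w \<in> Br i} = {j}" using uniq by blast
      then show ?thesis by simp
    next
      case False
      then have none: "{i. i < n \<and> w \<in> Br i} = {}" by blast
      show ?thesis unfolding none by simp
    qed
    have "card J \<le> 2"
      unfolding J_def by (rule order_trans[OF card_Un_le]) (use c1[of u] c1[of v] in linarith)
    moreover have "J \<subseteq> {..<n}" by (auto simp: J_def)
    ultimately obtain f where f: "J \<subseteq> f" "f \<subseteq> {..<n}" "card f = 2"
      using exists_subset_between[of J 2 "{..<n}"] n by auto
    then have "f \<in> edges ?K" by (simp add: complete_ugraph_def)
    then have "marg J T = marg J T'" using T(3) f(1) by (auto simp: same_def intro: marg_mono)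
    moreover have "lift a \<inter> e = lift (a \<inter> J) \<inter> e" if "a \<subseteq> {..<n}" for a
      using that by (auto simp: lift_def J_def e)
    ultimately show "marg e (image_mset lift T) = marg e (image_mset lift T')"
      using T(1,2) unfolding marg_def multiset.map_comp
      by (intro image_mset_factor[where h = "\<lambda>s. lift s \<inter> e"]) (auto simp: tables_def)
  qed
  \<comment> \<open>Along an edge inside a branch set, every row of the fiber shows a pattern that
    also occurs in the lifted table, and there the two labels are equal. Connectedness spreads this
    over the branch set.\<close>
  have const: "u \<in> s \<longleftrightarrow> v \<in> s"
    if M: "same (edges G) (image_mset lift T) M" "s \<in># M" and uv: "u \<in> Br i" "v \<in> Br i" "i < n" for M s i u v
  proof -
    have st: "x \<in> s \<longleftrightarrow> y \<in> s" if xy: "(x, y) \<in> adj_in G (Br i)" for x y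
    proof -
      have "x \<in> Br i" "y \<in> Br i" "{x, y} \<in> edges G" using xy by (auto simp: adj_in_def)
      then have "s \<inter> {x, y} \<in># marg {x, y} (image_mset lift T)"
        using M by (auto simp: same_def marg_def)
      then obtain a where "a \<in># T" "s \<inter> {x, y} = lift a \<inter> {x, y}" by (auto simp: marg_def)
      moreover from this have "a \<subseteq> {..<n}" using T(1) by (auto simp: tables_def)
      ultimately show ?thesis
        using mem_lift[OF \<open>x \<in> Br i\<close> uv(3), of a] mem_lift[OF \<open>y \<in> Br i\<close> uv(3), of a] by blast
    qed
    have "(u, v) \<in> (adj_in G (Br i))\<^sup>*" using Br(1)[OF uv(3)] uv by (simp add: connected_in_alt)
    then show ?thesis by (induction rule: rtrancl_induct) (use st in auto)
  qed
  have same_push: "same (edges ?K) T (image_mset push M)"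
    if M: "same (edges G) (image_mset lift T) M" for M
    unfolding same_def
  proof
    fix e assume e: "e \<in> edges ?K"
    then obtain i j where ij: "e = {i, j}" "i < n" "j < n" "i \<noteq> j"
      by (auto simp: complete_ugraph_def card_2_iff)
    obtain u v where uv: "u \<in> Br i" "v \<in> Br j" "{u, v} \<in> edges G" using Br(3) e ij(1) by blast
    \<comment> \<open>By constancy on branch sets, the labels at the representatives can be read off
      at \<open>u\<close> and \<open>v\<close>, the ends of an actual edge of
      \<open>G\<close>.\<close>
    define h where "h s = {l. l = i \<and> u \<in> s \<or> l = j \<and> v \<in> s}" for s
    have "image_mset (\<lambda>s. s \<inter> {u, v}) (image_mset lift T) = image_mset (\<lambda>s. s \<inter> {u, v}) M"
      using M uv(3) by (auto simp: same_def marg_def)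
    then have "image_mset (\<lambda>s. push s \<inter> e) (image_mset lift T) = image_mset (\<lambda>s. push s \<inter> e) M"
    proof (rule image_mset_factor[where h = h])
      have *: "push s \<inter> e = h (s \<inter> {u, v})" if "same (edges G) (image_mset lift T) L" "s \<in># L" for s L
        using const[OF that r[OF ij(2)] uv(1) ij(2)] const[OF that r[OF ij(3)] uv(2) ij(3)] ij
        by (auto simp: push_def h_def)
      show "push s \<inter> e = h (s \<inter> {u, v})" if "s \<in># M" for s using *[OF M that] .
      show "push s \<inter> e = h (s \<inter> {u, v})" if "s \<in># image_mset lift T" for s using *[OF same_refl that] .
    qed
    then have "marg e (image_mset push (image_mset lift T)) = marg e (image_mset push M)"
      by (simp add: marg_def multiset.map_comp o_def)
    then show "marg e T = marg e (image_mset push M)" by (simp only: push_lift_mset[OF T(1)])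
  qed
  have "(image_mset lift T, image_mset lift T') \<in> (moves k G)\<^sup>*"
    using all lift_tables T same_lift by blast
  then have "(image_mset push (image_mset lift T), image_mset push (image_mset lift T')) \<in> (moves k ?K)\<^sup>*"
  proof (induction rule: rtrancl_induct)
    case (step M N)
    have sM: "same (edges G) (image_mset lift T) M" using moves_rtrancl_same[OF step.hyps(1)] .
    have MN: "same (edges G) M N" "move k M N" using step.hyps(2) by (auto simp: moves_def)
    have "same (edges ?K) (image_mset push M) (image_mset push N)"
      by (rule same_trans[OF same_sym[OF same_push[OF sM]] same_push[OF same_trans[OF sM MN(1)]]])
    moreover have "move k (image_mset push M) (image_mset push N)"
      using MN(2) unfolding move_def by (metis image_mset_union size_image_mset)
    ultimately have "(image_mset push M, image_mset push N) \<in> moves k ?K"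
      using push_tables by (simp add: moves_def VK)
    then show ?case using step.IH by (rule rtrancl.rtrancl_into_rtrancl[rotated])
  qed simp
  then show ?thesis using T by (simp only: push_lift_mset)
qed

section \<open>Fibers of \<open>K\<^sub>3\<close> and \<open>K\<^sub>4\<close> that small moves
  cannot connect\<close>

definition num :: "('a set \<Rightarrow> bool) \<Rightarrow> 'a set multiset \<Rightarrow> nat" where
  "num P M = size (filter_mset P M)"

lemma num_add [simp]: "num P (M + N) = num P M + num P N"
  by (simp add: num_def)

lemma num_add_mset [simp]: "num P (add_mset a M) = (if P a then Suc (num P M) else num P M)"
  by (simp add: num_def)

lemma num_empty [simp]: "num P {#} = 0"
  by (simp add: num_def)

lemma num_pair_marg:
  assumes "same E M N" "{i, j} \<in> E"
  shows "num (\<lambda>a. (i \<in> a) = b \<and> (j \<in> a) = c) M = num (\<lambda>a. (i \<in> a) = b \<and> (j \<in> a) = c) N"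
proof -
  have *: "num (\<lambda>a. (i \<in> a) = b \<and> (j \<in> a) = c) M = num (\<lambda>a. (i \<in> a) = b \<and> (j \<in> a) = c) (marg {i, j} M)" for M
    by (induction M) auto
  have "marg {i, j} M = marg {i, j} N" using assms by (simp add: same_def)
  then show ?thesis using *[of M] *[of N] by simp
qed

lemma same_size:
  assumes "same E M N" "e \<in> E"
  shows "size M = size N"
proof -
  have "marg e M = marg e N" using assms by (simp add: same_def)
  then have "size (marg e M) = size (marg e N)" by (rule arg_cong)
  then show ?thesis by simp
qed

lemma complete_ugraph_edgeE:
  assumes "e \<in> edges (complete_ugraph n)"
  obtains i j where "e = {i, j}" "i < j" "j < n"
proof -
  have "card e = 2" "e \<subseteq> {..<n}" using assms by (simp_all add: complete_ugraph_def)
  then obtain i j where "e = {i, j}" "i \<noteq> j" "i < n" "j < n" by (auto simp: card_2_iff)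
  then show ?thesis
    using that[of i j] that[of j i] by (cases "i < j") (auto simp: insert_commute)
qed

definition pat3 :: "bool \<Rightarrow> bool \<Rightarrow> bool \<Rightarrow> nat set multiset \<Rightarrow> nat" where
  "pat3 b0 b1 b2 = num (\<lambda>a. (0 \<in> a) = b0 \<and> (1 \<in> a) = b1 \<and> (2 \<in> a) = b2)"

lemma pat3_sums:
  "num (\<lambda>a. (0 \<in> a) = b \<and> (1 \<in> a) = c) M = pat3 b c True M + pat3 b c False M"
  "num (\<lambda>a. (0 \<in> a) = b \<and> (2 \<in> a) = c) M = pat3 b True c M + pat3 b False c M"
  "num (\<lambda>a. (1 \<in> a) = b \<and> (2 \<in> a) = c) M = pat3 True b c M + pat3 False b c M"
  unfolding pat3_def by (induction M) auto

definition even3 :: "nat set multiset" where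
  "even3 = {#{}, {0, 1}, {0, 2}, {1, 2}#}"

text \<open>The rows of \<open>even3\<close> with the label of 0 flipped. The difference of the two
  tables is the parity vector of the triangle.\<close>

definition odd3 :: "nat set multiset" where
  "odd3 = {#{0}, {1}, {2}, {0, 1, 2}#}"

text \<open>The only property of small moves that the lower bounds use: some row stays in
  place.\<close>

lemma move_common_row:
  assumes "move k M N" "k < size M"
  obtains c M' N' where "M = add_mset c M'" "N = add_mset c N'"
proof -
  obtain A B C where ABC: "M = A + C" "N = B + C" "size A \<le> k"
    using assms(1) by (auto simp: move_def)
  then have "C \<noteq> {#}" using assms(2) by auto
  then obtain c C' where "C = add_mset c C'" by (metis multiset_cases)
  then show ?thesis using ABC that by simp
qed

text \<open>In this fiber every pair pattern occurs exactly once, so one even row forces all rows to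
  be even, and one odd row forces all to be odd. A move of three out of four rows keeps a row and
  with it the parity.\<close>

lemma not_moves_K3: "(even3, odd3) \<notin> (moves 3 (complete_ugraph 3))\<^sup>*"
proof
  let ?K = "complete_ugraph 3"
  have ed: "{0, 1} \<in> edges ?K" "{0, 2} \<in> edges ?K" "{1, 2} \<in> edges ?K"
    by (auto simp: complete_ugraph_def)
  have sums: "pat3 b c True M + pat3 b c False M = 1" "pat3 b True c M + pat3 b False c M = 1"
      "pat3 True b c M + pat3 False b c M = 1" if "same (edges ?K) even3 M" for M b c
    unfolding pat3_sums[symmetric] num_pair_marg[OF that ed(1), symmetric]
      num_pair_marg[OF that ed(2), symmetric] num_pair_marg[OF that ed(3), symmetric]
    by (cases b; cases c; simp add: even3_def)+
  have inv: "pat3 False False False M \<ge> 1" if "(even3, M) \<in> (moves 3 ?K)\<^sup>*" for M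
    using that
  proof (induction rule: rtrancl_induct)
    case base
    then show ?case by (simp add: even3_def pat3_def)
  next
    case (step M N)
    have M: "same (edges ?K) even3 M" using moves_rtrancl_same[OF step.hyps(1)] .
    have N: "same (edges ?K) even3 N" using M step.hyps(2) by (auto simp: moves_def intro: same_trans)
    have "size even3 = size M" by (rule same_size[OF M ed(1)])
    then have "3 < size M" by (simp add: even3_def)
    then obtain c M' N' where c: "M = add_mset c M'" "N = add_mset c N'"
      using step.hyps(2) move_common_row unfolding moves_def by blast
    have ge: "pat3 (0 \<in> c) (1 \<in> c) (2 \<in> c) M \<ge> 1" "pat3 (0 \<in> c) (1 \<in> c) (2 \<in> c) N \<ge> 1"
      unfolding c pat3_def by simp_all
    show ?case
      using ge step.IH sums[OF M, of True True] sums[OF M, of True False] sums[OF M, of False True]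
        sums[OF M, of False False] sums[OF N, of True True] sums[OF N, of True False]
        sums[OF N, of False True] sums[OF N, of False False]
      by (cases "0 \<in> c"; cases "1 \<in> c"; cases "2 \<in> c"; simp only:; linarith)
  qed
  assume "(even3, odd3) \<in> (moves 3 ?K)\<^sup>*"
  from inv[OF this] show False by (simp add: odd3_def pat3_def)
qed

definition pat4 :: "bool \<Rightarrow> bool \<Rightarrow> bool \<Rightarrow> bool \<Rightarrow> nat set multiset \<Rightarrow> nat" where
  "pat4 b0 b1 b2 b3 = num (\<lambda>a. (0 \<in> a) = b0 \<and> (1 \<in> a) = b1 \<and> (2 \<in> a) = b2 \<and> (3 \<in> a) = b3)"

lemma pat4_sums:
  "num (\<lambda>a. (0 \<in> a) = b \<and> (1 \<in> a) = c) M =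
     pat4 b c True True M + pat4 b c True False M + pat4 b c False True M + pat4 b c False False M"
  "num (\<lambda>a. (0 \<in> a) = b \<and> (2 \<in> a) = c) M =
     pat4 b True c True M + pat4 b True c False M + pat4 b False c True M + pat4 b False c False M"
  "num (\<lambda>a. (0 \<in> a) = b \<and> (3 \<in> a) = c) M =
     pat4 b True True c M + pat4 b True False c M + pat4 b False True c M + pat4 b False False c M"
  "num (\<lambda>a. (1 \<in> a) = b \<and> (2 \<in> a) = c) M =
     pat4 True b c True M + pat4 True b c False M + pat4 False b c True M + pat4 False b c False M"
  "num (\<lambda>a. (1 \<in> a) = b \<and> (3 \<in> a) = c) M =
     pat4 True b True c M + pat4 True b False c M + pat4 False b True c M + pat4 False b False c M"
  "num (\<lambda>a. (2 \<in> a) = b \<and> (3 \<in> a) = c) M =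
     pat4 True True b c M + pat4 True False b c M + pat4 False True b c M + pat4 False False b c M"
  unfolding pat4_def by (induction M) auto

text \<open>The two elements of an indispensable fiber of degree six of \<open>K\<^sub>4\<close>.\<close>

definition star4 :: "nat set multiset" where
  "star4 = {#{}, {}, {0, 1}, {0, 2}, {0, 3}, {1, 2, 3}#}"

definition costar4 :: "nat set multiset" where
  "costar4 = {#{0}, {0}, {1}, {2}, {3}, {0, 1, 2, 3}#}"

text \<open>A dichotomy decided by the row {1, 2, 3}: if it is present, the eleven patterns foreign
  to \<open>star4\<close> are absent; if it is missing, all rows of \<open>star4\<close> are absent.
  Hence tables from the two classes have no row in common.\<close>

lemma star4_fiber:
  assumes "same (edges (complete_ugraph 4)) star4 M"
  shows "pat4 False True True True M \<ge> 1 \<Longrightarrow>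
      pat4 True True True True M = 0 \<and> pat4 True True True False M = 0 \<and> pat4 True True False True M = 0 \<and>
      pat4 True False True True M = 0 \<and> pat4 True False False False M = 0 \<and> pat4 False True True False M = 0 \<and>
      pat4 False True False True M = 0 \<and> pat4 False False True True M = 0 \<and> pat4 False True False False M = 0 \<and>
      pat4 False False True False M = 0 \<and> pat4 False False False True M = 0"
    and "pat4 False True True True M = 0 \<Longrightarrow>
      pat4 False False False False M = 0 \<and> pat4 True True False False M = 0 \<and> pat4 True False True False M = 0 \<and>
      pat4 True False False True M = 0"
proof -
  let ?K = "complete_ugraph 4"
  have ed: "{0, 1} \<in> edges ?K" "{0, 2} \<in> edges ?K" "{0, 3} \<in> edges ?K"
     "{1, 2} \<in> edges ?K" "{1, 3} \<in> edges ?K" "{2, 3} \<in> edges ?K"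
    by (auto simp: complete_ugraph_def)
  note marg = ed[THEN num_pair_marg[OF assms]]
  have star4_num: "num (\<lambda>a. (0 \<in> a) = b \<and> (1 \<in> a) = c) star4 = (if c then 1 else 2)"
    "num (\<lambda>a. (0 \<in> a) = b \<and> (2 \<in> a) = c) star4 = (if c then 1 else 2)"
    "num (\<lambda>a. (0 \<in> a) = b \<and> (3 \<in> a) = c) star4 = (if c then 1 else 2)"
    "num (\<lambda>a. (1 \<in> a) = b \<and> (2 \<in> a) = c) star4 = (if b \<or> c then 1 else 3)"
    "num (\<lambda>a. (1 \<in> a) = b \<and> (3 \<in> a) = c) star4 = (if b \<or> c then 1 else 3)"
    "num (\<lambda>a. (2 \<in> a) = b \<and> (3 \<in> a) = c) star4 = (if b \<or> c then 1 else 3)" for b c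
    by (cases b; cases c; simp add: star4_def)+
  note sums = marg[unfolded star4_num, unfolded pat4_sums]
  define n where "n a b c d = pat4 a b c d M" for a b c d
  have tt: "n True True True True + n True True True False + n True True False True + n True True False False = 1"
    "n True True True True + n True True True False + n True False True True + n True False True False = 1"
    "n True True True True + n True True False True + n True False True True + n True False False True = 1"
    "n True True True True + n True True True False + n False True True True + n False True True False = 1"
    "n True True True True + n True True False True + n False True True True + n False True False True = 1"
    "n True True True True + n True False True True + n False True True True + n False False True True = 1"
    using sums(1)[where b = True and c = True] sums(2)[where b = True and c = True] sums(3)[where b = True and c = True] sums(4)[where b = True and c = True] sums(5)[where b = True and c = True] sums(6)[where b = True and c = True]
    by (simp_all add: n_def)
  have tf: "n True False True True + n True False True False + n True False False True + n True False False False = 2"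
    using sums(1)[where b = True and c = False]
    by (simp_all add: n_def)
  have ft: "n False True True True + n False True True False + n False True False True + n False True False False = 1"
    "n False True True True + n False True True False + n False False True True + n False False True False = 1"
    "n False True True True + n False True False True + n False False True True + n False False False True = 1"
    using sums(1)[where b = False and c = True] sums(2)[where b = False and c = True] sums(3)[where b = False and c = True]
    by (simp_all add: n_def)
  have ff: "n False False True True + n False False True False + n False False False True + n False False False False = 2"
    using sums(1)[where b = False and c = False]
    by (simp_all add: n_def)
  show "pat4 True True True True M = 0 \<and> pat4 True True True False M = 0 \<and> pat4 True True False True M = 0 \<and>
      pat4 True False True True M = 0 \<and> pat4 True False False False M = 0 \<and> pat4 False True True False M = 0 \<and>
      pat4 False True False True M = 0 \<and> pat4 False False True True M = 0 \<and> pat4 False True False False M = 0 \<and>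
      pat4 False False True False M = 0 \<and> pat4 False False False True M = 0"
    if "pat4 False True True True M \<ge> 1"
  proof -
    have 1: "n False True True True \<ge> 1" using that by (simp add: n_def)
    have 2: "n True True True True = 0" "n True True True False = 0" "n False True True False = 0"
        "n True True False True = 0" "n False True False True = 0" "n True False True True = 0" "n False False True True = 0"
      using tt(4-6) 1 by linarith+
    have 3: "n False True False False = 0" "n False False True False = 0" "n False False False True = 0"
      using ft 1 by linarith+
    have "n True False True False = 1" "n True False False True = 1"
      using tt(2,3) 2 by linarith+
    then have "n True False False False = 0" using tf by linarith
    then show ?thesis using 2 3 by (simp add: n_def)
  qed
  assume "pat4 False True True True M = 0"
  then have 0: "n False True True True = 0" by (simp add: n_def)
  \<comment> \<open>Otherwise the counts of {0, 1, 2}, {0, 1, 3} and {0, 2, 3} would have all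
    pairwise sums equal to one, so twice their total would be three.\<close>
  have "n True True True True \<noteq> 0"
  proof
    assume s: "n True True True True = 0"
    have "n True True True False + n True True False True \<ge> 1" using s 0 ft(1) tt(4,5) by linarith
    then have 1: "n True True True False + n True True False True = 1" using s tt(1) by linarith
    have "n True True True False + n True False True True \<ge> 1" using s 0 ft(2) tt(4,6) by linarith
    then have 2: "n True True True False + n True False True True = 1" using s tt(2) by linarith
    have "n True True False True + n True False True True \<ge> 1" using s 0 ft(3) tt(5,6) by linarith
    then have 3: "n True True False True + n True False True True = 1" using s tt(3) by linarith
    show False using 1 2 3 by presburger
  qed
  then have s: "n True True True True \<ge> 1" by simp
  have 1: "n True True False False = 0" "n True False True False = 0" "n True False False True = 0"
      "n False True True False = 0" "n False True False True = 0" "n False False True True = 0"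
    using tt s by linarith+
  then have "n False False True False = 1" "n False False False True = 1" using ft 0 by linarith+
  then have "n False False False False = 0" using ff 1 by linarith
  then show "pat4 False False False False M = 0 \<and> pat4 True True False False M = 0 \<and> pat4 True False True False M = 0 \<and>
      pat4 True False False True M = 0"
    using 1 by (simp add: n_def)
qed

text \<open>A move of four out of six rows keeps a row, and by the dichotomy a kept row cannot lead
  from one class to the other.\<close>

lemma not_moves_K4: "(star4, costar4) \<notin> (moves 4 (complete_ugraph 4))\<^sup>*"
proof
  let ?K = "complete_ugraph 4"
  have inv: "pat4 False True True True M \<ge> 1" if "(star4, M) \<in> (moves 4 ?K)\<^sup>*" for M
    using that
  proof (induction rule: rtrancl_induct)
    case base
    then show ?case by (simp add: star4_def pat4_def)
  next
    case (step M N)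
    have M: "same (edges ?K) star4 M" using moves_rtrancl_same[OF step.hyps(1)] .
    have N: "same (edges ?K) star4 N" using M step.hyps(2) by (auto simp: moves_def intro: same_trans)
    have "{0, 1} \<in> edges ?K" by (simp add: complete_ugraph_def)
    then have "size star4 = size M" by (rule same_size[OF M])
    then have "4 < size M" by (simp add: star4_def)
    then obtain c M' N' where c: "M = add_mset c M'" "N = add_mset c N'"
      using step.hyps(2) move_common_row unfolding moves_def by blast
    have ge: "pat4 (0 \<in> c) (1 \<in> c) (2 \<in> c) (3 \<in> c) M \<noteq> 0" "pat4 (0 \<in> c) (1 \<in> c) (2 \<in> c) (3 \<in> c) N \<noteq> 0"
      unfolding c pat4_def by simp_all
    show ?case
    proof (rule ccontr)
      assume "\<not> ?case"
      then have "pat4 False True True True N = 0" by simp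
      from star4_fiber(2)[OF N this] star4_fiber(1)[OF M step.IH] ge this show False
        by (cases "0 \<in> c"; cases "1 \<in> c"; cases "2 \<in> c"; cases "3 \<in> c") simp_all
    qed
  qed
  assume "(star4, costar4) \<in> (moves 4 ?K)\<^sup>*"
  from inv[OF this] show False by (simp add: costar4_def pat4_def)
qed

lemma same_even3_odd3: "same (edges (complete_ugraph 3)) even3 odd3"
  unfolding same_def
proof
  fix e assume "e \<in> edges (complete_ugraph 3)"
  then obtain i j where e: "e = {i, j}" "i < j" "j < 3" by (rule complete_ugraph_edgeE)
  then have "i = 0 \<and> j = 1 \<or> i = 0 \<and> j = 2 \<or> i = 1 \<and> j = 2" by auto
  then show "marg e even3 = marg e odd3"
    unfolding e(1) by (elim disjE conjE) (simp_all add: even3_def odd3_def add_mset_commute)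
qed

text \<open>\<open>costar4\<close> arises from \<open>star4\<close> by flipping the label of 0 in
  every row. This does not affect pairs without 0, and the marginal of \<open>star4\<close> on each
  pair containing 0 is symmetric under the flip.\<close>

lemma same_star4_costar4: "same (edges (complete_ugraph 4)) star4 costar4"
  unfolding same_def
proof
  fix e assume "e \<in> edges (complete_ugraph 4)"
  then obtain i j where e: "e = {i, j}" "i < j" "j < 4" by (rule complete_ugraph_edgeE)
  then have "i = 0 \<and> j = 1 \<or> i = 0 \<and> j = 2 \<or> i = 0 \<and> j = 3 \<or> i = 1 \<and> j = 2 \<or> i = 1 \<and> j = 3 \<or> i = 2 \<and> j = 3"
    by auto
  then show "marg e star4 = marg e costar4"
    unfolding e(1) by (elim disjE conjE) (simp_all add: star4_def costar4_def add_mset_commute)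
qed

section \<open>Tables as lattice vectors\<close>

definition lab :: "'a set \<Rightarrow> 'a set \<Rightarrow> 'a \<Rightarrow> nat" where
  "lab V a = (\<lambda>v\<in>V. if v \<in> a then 1 else 0)"

definition vec :: "'a set \<Rightarrow> 'a set multiset \<Rightarrow> 'a label_vec" where
  "vec V M = (\<Sum>a\<in>#M. frag_of (lab V a))"

lemma vec_add [simp]: "vec V (M + N) = vec V M + vec V N"
  by (simp add: vec_def)

lemma vec_add_mset [simp]: "vec V (add_mset a M) = frag_of (lab V a) + vec V M"
  by (simp add: vec_def)

lemma vec_empty [simp]: "vec V {#} = 0"
  by (simp add: vec_def)

lemma lab_in_labelings [simp]: "lab V a \<in> labelings V"
  by (auto simp: lab_def labelings_def)

lemma lab_inj: "lab V a = lab V b \<Longrightarrow> a \<subseteq> V \<Longrightarrow> b \<subseteq> V \<Longrightarrow> a = b"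
proof -
  assume eq: "lab V a = lab V b" and sub: "a \<subseteq> V" "b \<subseteq> V"
  have "v \<in> a \<longleftrightarrow> v \<in> b" if "v \<in> V" for v
    using fun_cong[OF eq, of v] that by (auto simp: lab_def split: if_splits)
  then show "a = b" using sub by blast
qed

lemma labelings_eq: "labelings V = lab V ` Pow V"
proof
  show "labelings V \<subseteq> lab V ` Pow V"
  proof
    fix f assume f: "f \<in> labelings V"
    have "f = lab V {v \<in> V. f v = 1}"
    proof
      fix v show "f v = lab V {v \<in> V. f v = 1} v"
        using f by (cases "v \<in> V") (auto simp: labelings_def lab_def PiE_def extensional_def)
    qed
    then show "f \<in> lab V ` Pow V" by blast
  qed
qed auto

lemma restrict_lab: "e \<subseteq> V \<Longrightarrow> restrict (lab V a) e = lab e (a \<inter> e)"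
  by (auto simp: lab_def restrict_def fun_eq_iff)

lemma lookup_vec:
  assumes "M \<in> tables V" "s \<subseteq> V"
  shows "Poly_Mapping.lookup (vec V M) (lab V s) = int (count M s)"
  using assms(1)
proof (induction M)
  case (add a M)
  then have "lab V s = lab V a \<longleftrightarrow> s = a" using lab_inj[of V s a] assms(2) by auto
  then show ?case using add by (simp add: lookup_add)
qed simp

lemma lookup_vec_nonneg: "0 \<le> Poly_Mapping.lookup (vec V M) f"
  by (induction M) (auto simp: lookup_add)

lemma nonneg_vec: "nonneg (vec V M)"
  by (simp add: nonneg_def lookup_vec_nonneg)

lemma vec_in_lattice: "vec V M \<in> lattice V"
proof (induction M)
  case (add a M)
  then show ?case
    using keys_add[of "frag_of (lab V a)" "vec V M"] lab_in_labelings[of V a] by (auto simp: lattice_def)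
qed (simp add: lattice_def)

lemma lattice_eqI:
  assumes "y \<in> lattice V" "z \<in> lattice V"
    and "\<And>s. s \<subseteq> V \<Longrightarrow> Poly_Mapping.lookup y (lab V s) = Poly_Mapping.lookup z (lab V s)"
  shows "y = z"
proof (rule poly_mapping_eqI)
  fix f
  show "Poly_Mapping.lookup y f = Poly_Mapping.lookup z f"
  proof (cases "f \<in> labelings V")
    case True
    then show ?thesis using assms(3) by (auto simp: labelings_eq)
  next
    case False
    then have "f \<notin> Poly_Mapping.keys y" "f \<notin> Poly_Mapping.keys z" using assms(1,2) by (auto simp: lattice_def)
    then show ?thesis by (simp add: in_keys_iff)
  qed
qed

lemma vec_inj: "M \<in> tables V \<Longrightarrow> N \<in> tables V \<Longrightarrow> vec V M = vec V N \<longleftrightarrow> M = N"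
proof
  assume M: "M \<in> tables V" and N: "N \<in> tables V" and eq: "vec V M = vec V N"
  have out: "count L s = 0" if "L \<in> tables V" "\<not> s \<subseteq> V" for L s
    using that by (auto simp: tables_def count_eq_zero_iff)
  show "M = N"
  proof (rule multiset_eqI)
    fix s show "count M s = count N s"
      using lookup_vec[OF M, of s] lookup_vec[OF N, of s] eq out[OF M, of s] out[OF N, of s]
      by (cases "s \<subseteq> V") auto
  qed
qed simp

lemma nonneg_eq_vec:
  assumes "finite V" "z \<in> lattice V" "nonneg z"
  obtains M where "M \<in> tables V" "z = vec V M"
proof -
  define M where "M = (\<Sum>s\<in>Pow V. replicate_mset (nat (Poly_Mapping.lookup z (lab V s))) s)"
  have M: "M \<in> tables V"
    using assms(1) by (auto simp: M_def tables_def set_mset_sum in_replicate_mset split: if_splits)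
  have "count M s = nat (Poly_Mapping.lookup z (lab V s))" if "s \<subseteq> V" for s
    using that assms(1) by (simp add: M_def count_sum sum.delta)
  then have "z = vec V M"
    using assms M by (intro lattice_eqI[OF assms(2) vec_in_lattice]) (auto simp: lookup_vec nonneg_def)
  then show ?thesis using M that by blast
qed

lemma proj_add: "proj e (y + z) = proj e y + proj e z"
  by (simp add: proj_def frag_extend_add)

lemma proj_diff: "proj e (y - z) = proj e y - proj e z"
  by (simp add: proj_def frag_extend_diff)

lemma proj_vec: "e \<subseteq> V \<Longrightarrow> proj e (vec V M) = vec e (marg e M)"
proof (induction M)
  case (add a M)
  then show ?case by (simp add: proj_add) (simp add: proj_def restrict_lab)
qed (simp add: proj_def)

lemma graph_proj_vec:
  assumes "finite_simple_graph G"
  shows "graph_proj G (vec (verts G) M) = graph_proj G (vec (verts G) N) \<longleftrightarrow> same (edges G) M N"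
proof -
  have "proj e (vec (verts G) M) = proj e (vec (verts G) N) \<longleftrightarrow> marg e M = marg e N" if "e \<in> edges G" for e
  proof -
    have "e \<subseteq> verts G" using assms that by (auto simp: finite_simple_graph_def)
    then show ?thesis by (simp add: proj_vec vec_inj)
  qed
  moreover have "graph_proj G y = graph_proj G z \<longleftrightarrow> (\<forall>e\<in>edges G. proj e y = proj e z)" for y z
    by (auto simp: graph_proj_def restrict_def fun_eq_iff split: if_splits)
  ultimately show ?thesis by (simp add: same_def)
qed

lemma lattice_diff: "y \<in> lattice V \<Longrightarrow> z \<in> lattice V \<Longrightarrow> y - z \<in> lattice V"
  using keys_diff[of y z] by (auto simp: lattice_def)

lemma lattice_add: "y \<in> lattice V \<Longrightarrow> z \<in> lattice V \<Longrightarrow> y + z \<in> lattice V"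
  using keys_add[of y z] by (auto simp: lattice_def)

lemma graph_kernel_iff:
  "z \<in> graph_kernel G \<longleftrightarrow> z \<in> lattice (verts G) \<and> (\<forall>e\<in>edges G. proj e z = 0)"
  unfolding graph_kernel_def graph_proj_def by (auto simp: fun_eq_iff restrict_def split: if_splits)

lemma l1_norm_lattice:
  assumes "finite V" "z \<in> lattice V"
  shows "l1_norm z = (\<Sum>s\<in>Pow V. \<bar>Poly_Mapping.lookup z (lab V s)\<bar>)"
proof -
  have inj: "inj_on (lab V) (Pow V)" using lab_inj by (auto simp: inj_on_def)
  have "l1_norm z = (\<Sum>f\<in>labelings V. \<bar>Poly_Mapping.lookup z f\<bar>)"
    unfolding l1_norm_def using assms
    by (intro sum.mono_neutral_left) (auto simp: lattice_def labelings_eq in_keys_iff)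
  then show ?thesis by (simp add: labelings_eq sum.reindex[OF inj])
qed

lemma l1_norm_vec_diff:
  assumes "finite V" "M \<in> tables V" "N \<in> tables V"
  shows "l1_norm (vec V M - vec V N) = (\<Sum>s\<in>Pow V. \<bar>int (count M s) - int (count N s)\<bar>)"
  using assms by (simp add: l1_norm_lattice lattice_diff vec_in_lattice lookup_minus lookup_vec)

lemma size_table:
  assumes "finite V" "M \<in> tables V"
  shows "size M = (\<Sum>s\<in>Pow V. count M s)"
  unfolding size_multiset_overloaded_eq
  using assms by (intro sum.mono_neutral_left) (auto simp: tables_def count_eq_zero_iff)

lemma l1_norm_move:
  assumes "finite V" "M \<in> tables V" "N \<in> tables V" "move k M N"
  shows "l1_norm (vec V N - vec V M) \<le> 2 * int k"
proof -
  obtain A B C where ABC: "M = A + C" "N = B + C" "size A \<le> k" "size B \<le> k"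
    using assms(4) by (auto simp: move_def)
  then have AB: "A \<in> tables V" "B \<in> tables V" using assms by auto
  have "l1_norm (vec V N - vec V M) = (\<Sum>s\<in>Pow V. \<bar>int (count B s) - int (count A s)\<bar>)"
    using l1_norm_vec_diff[OF assms(1) AB(2,1)] by (simp add: ABC)
  also have "\<dots> \<le> (\<Sum>s\<in>Pow V. int (count B s) + int (count A s))"
    by (intro sum_mono) auto
  also have "\<dots> = int (size B) + int (size A)"
    using assms(1) AB by (simp add: sum.distrib size_table)
  finally show ?thesis using ABC by linarith
qed

text \<open>After cancelling the common rows, the norm counts the removed and the added rows. Equal
  sizes split it evenly, so at most \<open>k\<close> rows are removed and at most \<open>k\<close>
  added.\<close>

lemma move_of_l1_norm:
  assumes "finite V" "M \<in> tables V" "N \<in> tables V" "size M = size N"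
    and "l1_norm (vec V N - vec V M) \<le> 2 * int k"
  shows "move k M N"
proof -
  have MN: "N - M \<in> tables V" "M - N \<in> tables V"
    using assms(2,3) by (auto simp: tables_def dest: in_diffD)
  have dec: "M = (M - N) + M \<inter># N" "N = (N - M) + M \<inter># N"
    by (auto simp: multiset_eq_iff)
  have s: "size (M - N) = size (N - M)"
    using assms(4) arg_cong[OF dec(1), of size] arg_cong[OF dec(2), of size] by simp
  have "int (size (N - M) + size (M - N)) = (\<Sum>s\<in>Pow V. \<bar>int (count N s) - int (count M s)\<bar>)"
    unfolding size_table[OF assms(1) MN(1)] size_table[OF assms(1) MN(2)] sum.distrib[symmetric]
    by (auto intro!: sum.cong)
  also have "\<dots> \<le> 2 * int k" using assms(5) l1_norm_vec_diff[OF assms(1,3,2)] by simp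
  finally have "size (N - M) \<le> k" "size (M - N) \<le> k" using s by linarith+
  then show ?thesis
    unfolding move_def
    using dec by blast
qed

text \<open>A bound on the norm bounds every coordinate, and there are finitely many integral
  coordinates.\<close>

lemma finite_bounded_lattice:
  assumes "finite V"
  shows "finite {z \<in> lattice V. l1_norm z \<le> c}"
proof -
  have finL: "finite (labelings V)" using assms by (simp add: labelings_eq)
  let ?g = "\<lambda>z. restrict (Poly_Mapping.lookup z) (labelings V)"
  have "inj_on ?g {z \<in> lattice V. l1_norm z \<le> c}"
  proof (rule inj_onI)
    fix y z assume yz: "y \<in> {z \<in> lattice V. l1_norm z \<le> c}" "z \<in> {z \<in> lattice V. l1_norm z \<le> c}" "?g y = ?g z"
    show "y = z"
    proof (rule lattice_eqI[of _ V])
      fix s show "Poly_Mapping.lookup y (lab V s) = Poly_Mapping.lookup z (lab V s)"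
        using fun_cong[OF yz(3), of "lab V s"] by simp
    qed (use yz in auto)
  qed
  moreover have "?g ` {z \<in> lattice V. l1_norm z \<le> c} \<subseteq> labelings V \<rightarrow>\<^sub>E {-c..c}"
  proof clarify
    fix z assume z: "z \<in> lattice V" "l1_norm z \<le> c"
    have "\<bar>Poly_Mapping.lookup z f\<bar> \<le> c" if "f \<in> labelings V" for f
    proof -
      from that[unfolded labelings_eq] obtain s where s: "f = lab V s" "s \<in> Pow V" by (rule imageE)
      have "\<bar>Poly_Mapping.lookup z (lab V s)\<bar> \<le> (\<Sum>s\<in>Pow V. \<bar>Poly_Mapping.lookup z (lab V s)\<bar>)"
        using s assms by (intro member_le_sum) auto
      then show ?thesis using s z l1_norm_lattice[OF assms z(1)] by simp
    qed
    then show "?g z \<in> labelings V \<rightarrow>\<^sub>E {-c..c}" by (auto simp: abs_le_iff minus_le_iff)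
  qed
  moreover have "finite (labelings V \<rightarrow>\<^sub>E {-c..c})" using finL by (intro finite_PiE) auto
  ultimately show ?thesis by (meson finite_imageD finite_subset)
qed

section \<open>Markov width as connectivity of fibers by moves\<close>

definition width_le :: "'a ugraph \<Rightarrow> nat \<Rightarrow> bool" where
  "width_le G k \<longleftrightarrow> (\<exists>B. markov_basis G B \<and> (\<forall>v\<in>B. l1_norm v \<le> 2 * int k))"

text \<open>A nonempty set in \<open>enat\<close> attains its infimum, so a finite bound on the
  width comes from an actual Markov basis.\<close>

lemma markov_width_le_iff: "markov_width G \<le> enat k \<longleftrightarrow> (\<exists>l\<le>k. width_le G l)"
proof
  assume le: "markov_width G \<le> enat k"
  let ?S = "{enat k | k. width_le G k}"
  have w: "markov_width G = Inf ?S" by (simp add: markov_width_def width_le_def)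
  have "?S \<noteq> {}"
  proof
    assume "?S = {}"
    then have "markov_width G = \<infinity>" unfolding w by (simp only: Inf_empty top_enat_def)
    then show False using le by simp
  qed
  then have "Inf ?S \<in> ?S" by (meson ex_in_conv wellorder_InfI)
  then show "\<exists>l\<le>k. width_le G l" using le unfolding w by auto
next
  assume "\<exists>l\<le>k. width_le G l"
  then obtain l where "l \<le> k" "width_le G l" by blast
  then have "markov_width G \<le> enat l" unfolding markov_width_def width_le_def by (intro Inf_lower) blast
  then show "markov_width G \<le> enat k" using \<open>l \<le> k\<close> by (meson enat_ord_simps(1) order_trans)
qed

text \<open>The basis consists of all kernel vectors of norm at most \<open>2 * k\<close>. Every
  move is such a vector, and the partial sums along a path are vectors of tables, hence
  non-negative.\<close>

lemma moves_imp_width_le: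
  assumes G: "finite_simple_graph G"
    and conn: "\<And>M N. M \<in> tables (verts G) \<Longrightarrow> N \<in> tables (verts G) \<Longrightarrow> same (edges G) M N \<Longrightarrow> (M, N) \<in> (moves k G)\<^sup>*"
  shows "width_le G k"
proof -
  let ?V = "verts G"
  have finV: "finite ?V" using G by (simp add: finite_simple_graph_def)
  define B where "B = {z \<in> graph_kernel G. l1_norm z \<le> 2 * int k}"
  have "finite B"
    by (rule finite_subset[OF _ finite_bounded_lattice[OF finV, of "2 * int k"]]) (auto simp: B_def graph_kernel_def)
  have path: "\<exists>us. set us \<subseteq> B \<and> vec ?V M + sum_list us = vec ?V N \<and>
      (\<forall>l\<le>length us. nonneg (vec ?V M + sum_list (take l us)))" if "(M, N) \<in> (moves k G)\<^sup>*" for M N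
    using that
  proof (induction rule: rtrancl_induct)
    case base
    then show ?case by (intro exI[of _ "[]"]) (simp add: nonneg_vec)
  next
    case (step N N')
    then obtain us where us: "set us \<subseteq> B" "vec ?V M + sum_list us = vec ?V N"
      "\<forall>l\<le>length us. nonneg (vec ?V M + sum_list (take l us))" by blast
    define u where "u = vec ?V N' - vec ?V N"
    have NN: "N \<in> tables ?V" "N' \<in> tables ?V" "same (edges G) N N'" "move k N N'"
      using step.hyps(2) by (auto simp: moves_def)
    have "proj e u = 0" if "e \<in> edges G" for e
    proof -
      have "e \<subseteq> ?V" using G that by (auto simp: finite_simple_graph_def)
      then show ?thesis using NN(3) that by (simp add: u_def proj_diff proj_vec same_def)
    qed
    then have "u \<in> B"
      using l1_norm_move[OF finV NN(1,2,4)]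
      by (simp add: B_def graph_kernel_iff u_def lattice_diff vec_in_lattice)
    moreover have "vec ?V M + sum_list (us @ [u]) = vec ?V N'"
      using us(2) by (simp add: u_def algebra_simps)
    moreover have "nonneg (vec ?V M + sum_list (take l (us @ [u])))" if l: "l \<le> length (us @ [u])" for l
    proof (cases "l \<le> length us")
      case True
      then show ?thesis using us(3) by simp
    next
      case False
      then have "take l (us @ [u]) = us @ [u]" using l by simp
      then show ?thesis using \<open>vec ?V M + sum_list (us @ [u]) = vec ?V N'\<close> by (simp only: nonneg_vec)
    qed
    ultimately show ?case using us(1) by (intro exI[of _ "us @ [u]"]) auto
  qed
  have "markov_basis G B"
    unfolding markov_basis_def
  proof (intro conjI ballI impI)
    show "finite B" by fact
    show "B \<subseteq> graph_kernel G" by (auto simp: B_def)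
    fix v1 v2 assume v: "v1 \<in> lattice ?V" "v2 \<in> lattice ?V"
      and p: "nonneg v1 \<and> nonneg v2 \<and> graph_proj G v1 = graph_proj G v2"
    obtain M where M: "M \<in> tables ?V" "v1 = vec ?V M" using nonneg_eq_vec[OF finV v(1)] p by blast
    obtain N where N: "N \<in> tables ?V" "v2 = vec ?V N" using nonneg_eq_vec[OF finV v(2)] p by blast
    have "same (edges G) M N" using p M N graph_proj_vec[OF G] by blast
    from path[OF conn[OF M(1) N(1) this]]
    show "\<exists>us. set us \<subseteq> B \<union> uminus ` B \<and> v1 + sum_list us = v2 \<and>
       (\<forall>l\<in>{1..length us}. nonneg (v1 + sum_list (take l us)))"
      unfolding M(2) N(2) by auto
  qed
  then show ?thesis unfolding width_le_def B_def by blast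
qed

lemma l1_norm_uminus: "l1_norm (- z) = l1_norm z"
  by (simp add: l1_norm_def)

text \<open>Every partial sum is non-negative and thus a table. An edge is what forces consecutive
  tables to have equally many rows, so that a norm of at most \<open>2 * k\<close> means a move of
  at most \<open>k\<close> rows.\<close>

lemma width_le_imp_moves:
  assumes G: "finite_simple_graph G" and w: "width_le G k" and ne: "edges G \<noteq> {}"
    and M: "M \<in> tables (verts G)" and N: "N \<in> tables (verts G)" and s: "same (edges G) M N"
  shows "(M, N) \<in> (moves k G)\<^sup>*"
proof -
  let ?V = "verts G"
  have finV: "finite ?V" using G by (simp add: finite_simple_graph_def)
  obtain B where B: "markov_basis G B" "\<forall>v\<in>B. l1_norm v \<le> 2 * int k" using w by (auto simp: width_le_def)
  have "B \<subseteq> graph_kernel G" using B(1) by (simp add: markov_basis_def)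
  then have u: "u \<in> lattice ?V \<and> (\<forall>e\<in>edges G. proj e u = 0) \<and> l1_norm u \<le> 2 * int k" if "u \<in> B \<union> uminus ` B" for u
    using that B(2) unfolding graph_kernel_iff
    by (auto simp: l1_norm_uminus lattice_def proj_def frag_extend_minus graph_kernel_iff subset_iff)
  have path: "(M, N) \<in> (moves k G)\<^sup>*"
    if "M \<in> tables ?V" "set us \<subseteq> B \<union> uminus ` B" "vec ?V M + sum_list us = vec ?V N"
      "\<forall>l\<in>{1..length us}. nonneg (vec ?V M + sum_list (take l us))" for M us
    using that
  proof (induction us arbitrary: M)
    case Nil
    then show ?case using N by (simp add: vec_inj)
  next
    case (Cons x us)
    have x: "x \<in> lattice ?V" "\<forall>e\<in>edges G. proj e x = 0" "l1_norm x \<le> 2 * int k" using u Cons.prems(2) by auto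
    have "nonneg (vec ?V M + x)" using bspec[OF Cons.prems(4), of 1] by simp
    then obtain L where L: "L \<in> tables ?V" "vec ?V M + x = vec ?V L"
      using nonneg_eq_vec[OF finV, of "vec ?V M + x"] x(1) by (auto simp: lattice_add vec_in_lattice)
    have "same (edges G) M L"
    proof -
      have "graph_proj G (vec ?V M) = graph_proj G (vec ?V L)"
        unfolding L(2)[symmetric] graph_proj_def using x(2) by (intro restrict_ext) (simp add: proj_add)
      then show ?thesis by (simp add: graph_proj_vec[OF G])
    qed
    moreover from this have "size M = size L" using ne same_size by blast
    then have "move k M L"
      using move_of_l1_norm[OF finV Cons.prems(1) L(1)] x(3) by (simp add: L(2)[symmetric])
    ultimately have st: "(M, L) \<in> moves k G" using Cons.prems(1) L(1) by (simp add: moves_def)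
    have "nonneg (vec ?V L + sum_list (take l us))" if "l \<in> {1..length us}" for l
      using bspec[OF Cons.prems(4), of "Suc l"] that L(2) by (simp add: add.assoc[symmetric])
    then have "(L, N) \<in> (moves k G)\<^sup>*"
      using Cons.prems(2,3) L by (intro Cons.IH) (auto simp: add.assoc[symmetric])
    then show ?case using st by (meson converse_rtrancl_into_rtrancl)
  qed
  obtain us where "set us \<subseteq> B \<union> uminus ` B" "vec ?V M + sum_list us = vec ?V N"
      "\<forall>l\<in>{1..length us}. nonneg (vec ?V M + sum_list (take l us))"
    using B(1) s unfolding markov_basis_def graph_proj_vec[OF G, symmetric]
    by (metis nonneg_vec vec_in_lattice)
  then show ?thesis using path M by blast
qed

lemma moves_sym: "(M, N) \<in> (moves k G)\<^sup>* \<Longrightarrow> (N, M) \<in> (moves k G)\<^sup>*"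
proof -
  have "sym (moves k G)" by (auto simp: sym_def moves_def intro: same_sym move_sym)
  then show "(M, N) \<in> (moves k G)\<^sup>* \<Longrightarrow> (N, M) \<in> (moves k G)\<^sup>*"
    by (meson sym_rtrancl symD)
qed

text \<open>Labels of isolated vertices are not controlled by the edge marginals; they can be reset to zero
  row by row. Without edges not even the number of rows is determined, and rows may be deleted.\<close>

lemma linked_imp_moves:
  assumes G: "finite_simple_graph G" and l: "linked k (verts G) (faces G) {verts G}" and k: "1 \<le> k"
    and M: "M \<in> tables (verts G)" and N: "N \<in> tables (verts G)" and s: "same (edges G) M N"
  shows "(M, N) \<in> (moves k G)\<^sup>*"
proof (cases "edges G = {}")
  case True
  have "(L, {#}) \<in> (moves k G)\<^sup>*" if "L \<in> tables (verts G)" for L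
    using that
  proof (induction L)
    case (add a L)
    have "move k (add_mset a L) L"
      unfolding move_def by (intro exI[of _ "{#a#}"] exI[of _ "{#}"] exI[of _ L]) (use k in simp)
    then have "(add_mset a L, L) \<in> moves k G" using add.prems True by (simp add: moves_def)
    then show ?case using add by (meson converse_rtrancl_into_rtrancl tables_add_mset)
  qed simp
  then show ?thesis using M N moves_sym by (meson rtrancl_trans)
next
  case False
  let ?V = "verts G" and ?W = "\<Union>(edges G)"
  have WV: "?W \<subseteq> ?V" using G by (auto simp: finite_simple_graph_def)
  \<comment> \<open>The rows already reset are collected in \<open>C\<close>, which therefore varies
    in the induction.\<close>
  have reset: "(A + C, marg ?W A + C) \<in> (moves k G)\<^sup>*" if "A + C \<in> tables ?V" for A C
    using that
  proof (induction A arbitrary: C)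
    case (add a A)
    let ?a = "a \<inter> ?W"
    have tab: "add_mset ?a (A + C) \<in> tables ?V" using add.prems by auto
    have "same (edges G) {#a#} {#?a#}"
      unfolding same_def marg_def by (auto intro!: arg_cong[where f = "\<lambda>s. {#s#}"])
    then have "same (edges G) ({#a#} + (A + C)) ({#?a#} + (A + C))" by (simp only: same_add_cancel)
    moreover have "move k ({#a#} + (A + C)) ({#?a#} + (A + C))"
      unfolding move_def using k by (intro exI[of _ "{#a#}"] exI[of _ "{#?a#}"] exI[of _ "A + C"]) simp
    ultimately have "(add_mset a A + C, A + add_mset ?a C) \<in> moves k G"
      using add.prems tab by (simp add: moves_def)
    moreover have "(A + add_mset ?a C, marg ?W A + add_mset ?a C) \<in> (moves k G)\<^sup>*"
      using tab by (intro add.IH) simp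
    ultimately show ?case by (simp add: converse_rtrancl_into_rtrancl)
  qed simp
  have 1: "(L, marg ?W L) \<in> (moves k G)\<^sup>*" if "L \<in> tables ?V" for L
    using reset[of L "{#}"] that by simp
  let ?M = "marg ?W M" and ?N = "marg ?W N"
  have tab: "?M \<in> tables ?V" "?N \<in> tables ?V" by (rule tables_mono[OF marg_in_tables WV])+
  have "marg f ?M = marg f ?N" if f: "f \<in> faces G" for f
  proof -
    obtain e0 where e0: "e0 \<in> edges G" using False by blast
    \<comment> \<open>A face is an edge, or a vertex on an edge, or, when empty or an isolated
      vertex, disjoint from \<open>?W\<close>. After the reset its marginal is thus governed by an
      edge in all cases.\<close>
    consider "f \<in> edges G" | "f \<inter> ?W = {}" | v where "f = {v}" "v \<in> ?W" using f by (auto simp: faces_def)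
    then have "\<exists>e\<in>edges G. f \<inter> ?W \<subseteq> e" using e0 by cases blast+
    then obtain e where e: "e \<in> edges G" "f \<inter> ?W \<subseteq> e" by blast
    have "marg e M = marg e N" using s e(1) by (simp add: same_def)
    then show ?thesis unfolding marg_marg by (rule marg_mono) (rule e(2))
  qed
  then have "same (faces G) ?M ?N" by (simp add: same_def)
  then have "(?M, ?N) \<in> (steps k ?V (faces G) {?V})\<^sup>*" using l tab by (simp add: linked_def)
  moreover have "steps k ?V (faces G) {?V} \<subseteq> moves k G"
  proof clarify
    fix A C assume AC: "(A, C) \<in> steps k ?V (faces G) {?V}"
    then have "A \<in> tables ?V" "C \<in> tables ?V" "same (edges G) A C"
      by (auto simp: steps_def faces_def same_def)
    moreover have "move k A C"
      using AC by (auto simp: steps_def same_insert marg_id)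
    ultimately show "(A, C) \<in> moves k G" by (simp add: moves_def)
  qed
  ultimately have "(?M, ?N) \<in> (moves k G)\<^sup>*" using rtrancl_mono by blast
  then show ?thesis using 1[OF M] moves_sym[OF 1[OF N]] by (meson rtrancl_trans)
qed

text \<open>A Markov basis of width \<open>l\<close> would connect all fibers of \<open>G\<close> by
  moves of \<open>l\<close> rows, and the minor passes this on to the complete graph. With
  \<open>2 \<le> n\<close> the minor has an edge, which provides the edge of \<open>G\<close> needed
  to turn basis vectors into moves.\<close>

lemma minor_not_width_le:
  assumes G: "finite_simple_graph G" and m: "is_minor (complete_ugraph n) G" and n: "2 \<le> n"
    and T: "T \<in> tables {..<n}" "T' \<in> tables {..<n}" "same (edges (complete_ugraph n)) T T'"
      "(T, T') \<notin> (moves k (complete_ugraph n))\<^sup>*"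
    and l: "l \<le> k"
  shows "\<not> width_le G l"
proof
  assume w: "width_le G l"
  have "{0, 1} \<in> edges (complete_ugraph n)" using n by (auto simp: complete_ugraph_def)
  then have "edges G \<noteq> {}" using m unfolding is_minor_def by (metis empty_iff)
  then have "(T, T') \<in> (moves l (complete_ugraph n))\<^sup>*"
    using moves_complete_minor[OF m n G _ T(1-3)] width_le_imp_moves[OF G w] by blast
  moreover have "moves l (complete_ugraph n) \<subseteq> moves k (complete_ugraph n)"
    using l move_mono by (auto simp: moves_def)
  ultimately show False using T(4) rtrancl_mono by blast
qed

theorem theorem7:
  fixes G :: "'a ugraph"
  assumes "finite_simple_graph G"
  shows "(markov_width G \<le> 4 \<longleftrightarrow> \<not> is_minor (complete_ugraph 4) G) \<and>
         (markov_width G = 4 \<longleftrightarrow> \<not> is_forest G \<and> \<not> is_minor (complete_ugraph 4) G)"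
proof -
  note G = assms
  have le4: "markov_width G \<le> 4 \<longleftrightarrow> \<not> is_minor (complete_ugraph 4) G"
  proof
    assume "markov_width G \<le> 4"
    then obtain l where l: "l \<le> 4" "width_le G l"
      using markov_width_le_iff[of G 4] by (auto simp: numeral_eq_enat)
    show "\<not> is_minor (complete_ugraph 4) G"
    proof
      assume m: "is_minor (complete_ugraph 4) G"
      have "star4 \<in> tables {..<4}" "costar4 \<in> tables {..<4}" by (auto simp: star4_def costar4_def)
      from minor_not_width_le[OF G m _ this same_star4_costar4 not_moves_K4 l(1)] l(2) show False by simp
    qed
  next
    assume "\<not> is_minor (complete_ugraph 4) G"
    then have "width_le G 4"
      using moves_imp_width_le[OF G] linked_imp_moves[OF G linked_K4_minor_free[OF G]] by simp
    then show "markov_width G \<le> 4"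
      using markov_width_le_iff[of G 4] by (auto simp: numeral_eq_enat)
  qed
  \<comment> \<open>Width four means at most four but not at most three. Forests have width at most
    two, while any cycle gives a triangle minor and so excludes three.\<close>
  have le3: "markov_width G \<le> 3 \<longleftrightarrow> is_forest G"
  proof
    assume "markov_width G \<le> 3"
    then obtain l where l: "l \<le> 3" "width_le G l"
      using markov_width_le_iff[of G 3] by (auto simp: numeral_eq_enat)
    show "is_forest G"
    proof (rule ccontr)
      assume "\<not> is_forest G"
      then obtain xs where "is_cycle G xs" by (auto simp: is_forest_def)
      then have m: "is_minor (complete_ugraph 3) G" by (rule triangle_minor_of_cycle)
      have "even3 \<in> tables {..<3}" "odd3 \<in> tables {..<3}" by (auto simp: even3_def odd3_def)
      from minor_not_width_le[OF G m _ this same_even3_odd3 not_moves_K3 l(1)] l(2) show False by simp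
    qed
  next
    assume "is_forest G"
    then have "width_le G 2"
      using moves_imp_width_le[OF G] linked_imp_moves[OF G linked_forest[OF G]] by simp
    then show "markov_width G \<le> 3"
      using markov_width_le_iff[of G 3] by (auto simp: numeral_eq_enat intro!: exI[of _ 2])
  qed
  have "w = 4 \<longleftrightarrow> w \<le> 4 \<and> \<not> w \<le> 3" for w :: enat
    by (cases w) (auto simp: numeral_eq_enat)
  then show ?thesis using le3 le4 by blast
qed

end
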